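(* For functionals $\mathcal F=\mathcal F[f_1,\mathbf E_1,\mathbf B_1]$ and $\mathcal G=\mathcal G[f_1,\mathbf E_1,\mathbf B_1]$ of a scalar function $f_1=f_1(\mathbf x,\mathbf v)$ on $\Omega\times\mathbb R^3$ and vector fields $\mathbf E_1=\mathbf E_1(\mathbf x)$, $\mathbf B_1=\mathbf B_1(\mathbf x)$ on $\Omega$ with values in $\mathbb R^3$, define $$ \begin{aligned} \{\mathcal F,\mathcal G\} &= \int_\Omega \left[\left(\nabla_{\mathbf x}\times\frac{\delta\mathcal F}{\delta\mathbf E_1}\right)\cdot\frac{\delta\mathcal G}{\delta\mathbf B_1}-\frac{\delta\mathcal F}{\delta\mathbf B_1}\cdot\left(\nabla_{\mathbf x}\times\frac{\delta\mathcal G}{\delta\mathbf E_1}\right)\right]d\mathbf x\\ &\quad+\frac{1}{v_{\mathrm{th}}^2\,\epsilon}\int_{\Omega\times\mathbb R^3}\left[\frac{\delta\mathcal F}{\delta f_1}\,\frac{\delta\mathcal G}{\delta\mathbf E_1}\cdot\mathbf v-\frac{\delta\mathcal F}{\delta\mathbf E_1}\cdot\mathbf v\,\frac{\delta\mathcal G}{\delta f_1}\right]f_0\,d\mathbf x\,d\mathbf v\\ &\quad+\frac12\,\frac{1}{\alpha^2v_{\mathrm{th}}^2}\int_{\Omega\times\mathbb R^3}f_0\left[\mathbf v\cdot\left(\left(\nabla_{\mathbf x}\frac{\delta\mathcal F}{\delta f_1}\right)\frac{\delta\mathcal G}{\delta f_1}-\frac{\delta\mathcal F}{\delta f_1}\nabla_{\mathbf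 x}\frac{\delta\mathcal G}{\delta f_1}\right)\right.\\ &\qquad\qquad\left.+\frac1\epsilon\left(\mathbf E_0+\mathbf v\times\mathbf B_0\right)\cdot\left(\left(\nabla_{\mathbf v}\frac{\delta\mathcal F}{\delta f_1}\right)\frac{\delta\mathcal G}{\delta f_1}-\frac{\delta\mathcal F}{\delta f_1}\nabla_{\mathbf v}\frac{\delta\mathcal G}{\delta f_1}\right)\right]d\mathbf x\,d\mathbf v . \end{aligned} $$ Then $\{\cdot,\cdot\}$ is a Poisson bracket: it is bilinear, antisymmetric, satisfies the Leibniz rule $\{\mathcal F\mathcal G,\mathcal K\}=\mathcal F\{\mathcal G,\mathcal K\}+\{\mathcal F,\mathcal K\}\mathcal G$, and satisfies the Jacobi identity $\{\{\mathcal F,\mathcal G\},\mathcal K\}+\{\{\mathcal K,\mathcal F\},\mathcal G\}+\{\{\mathcal G,\mathcal K\},\mathcal F\}=0$ for all functionals $\mathcal F,\mathcal G,\mathcal K$.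
   Context: $\Omega\subseteq\mathbb R^3$ is the spatial domain, $\mathbf x\in\Omega$, $\mathbf v\in\mathbb R^3$. The constants are $\alpha\neq0$, $\epsilon\neq 0$ (real, its sign being that of the charge of the species) and $v_{\mathrm{th}}>0$. The time-independent background functions are $$f_0(\mathbf x,\mathbf v)=\frac{n_0(\mathbf x)}{(\sqrt{2\pi}\,v_{\mathrm{th}})^3}\exp\left(-\frac{|\mathbf v|^2}{2v_{\mathrm{th}}^2}\right),\qquad \mathbf E_0(\mathbf x)=v_{\mathrm{th}}^2\,\epsilon\,\nabla_{\mathbf x}\ln n_0(\mathbf x),\qquad \mathbf B_0\in\mathbb R^3\ \text{constant},$$ with $n_0>0$ a given smooth density on $\Omega$. They satisfy the equilibrium condition $\mathbf v\cdot\nabla_{\mathbf x}f_0+\frac1\epsilon(\mathbf E_0+\mathbf v\times\mathbf B_0)\cdot\nabla_{\mathbf v}f_0=0$. The functional derivatives are defined by $$\frac{d}{ds}\Big|_{s=0}\mathcal F[f_1+s\,\delta f,\mathbf E_1+s\,\delta\mathbf E,\mathbf B_1+s\,\delta\mathbf B]=\int_{\Omega\times\mathbb R^3}\frac{\delta\mathcal F}{\delta f_1}\,\delta f\,d\mathbf x\,d\mathbf v+\int_\Omega\frac{\delta\mathcal F}{\delta\mathbf E_1}\cdot\delta\mathbf E\,d\mathbf x+\int_\Omega\frac{\delta\mathcal F}{\delta\mathbf B_1}\cdot\delta\mathbf B\,d\mathbf x .$$ The setting is the usual formal one for infinite-dimensional Hamiltonian systems: functionals are smooth (with symmetric second derivatives),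 their functional derivatives are sufficiently regular and of sufficiently controlled growth in $\mathbf v$ for all expressions to be defined, and integrations by parts in $\mathbf x$ and $\mathbf v$ produce no boundary terms. *)

theory Defs
  imports "HOL-Analysis.Analysis"
begin

section \<open>Vector calculus on \<open>\<real>\<^sup>3\<close>\<close>

text \<open>
  For an open set \<open>S\<close> this is the class \<open>C\<^sup>\<infinity>(S)\<close>: \<open>f\<close> is differentiable on \<open>S\<close> and so are all
  iterated partial derivatives.
\<close>

coinductive smooth_on ::
  "'a::euclidean_space set \<Rightarrow> ('a \<Rightarrow> 'b::real_normed_vector) \<Rightarrow> bool" for S where
  "(\<And>x. x \<in> S \<Longrightarrow> f differentiable (at x)) \<Longrightarrow>
   (\<And>b. b \<in> Basis \<Longrightarrow> smooth_on S (\<lambda>x. frechet_derivative f (at x) b)) \<Longrightarrow>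
   smooth_on S f"

definition partial :: "3 \<Rightarrow> (real^3 \<Rightarrow> real) \<Rightarrow> real^3 \<Rightarrow> real" where
  "partial i h x = frechet_derivative h (at x) (axis i 1)"

definition grad :: "(real^3 \<Rightarrow> real) \<Rightarrow> real^3 \<Rightarrow> real^3" where
  "grad h x = (\<chi> i. partial i h x)"

definition divergence :: "(real^3 \<Rightarrow> real^3) \<Rightarrow> real^3 \<Rightarrow> real" where
  "divergence A x = (\<Sum>i\<in>UNIV. partial i (\<lambda>y. A y $ i) x)"

definition curl :: "(real^3 \<Rightarrow> real^3) \<Rightarrow> real^3 \<Rightarrow> real^3" where
  "curl A x = vector
    [partial 2 (\<lambda>y. A y $ 3) x - partial 3 (\<lambda>y. A y $ 2) x,
     partial 3 (\<lambda>y. A y $ 1) x - partial 1 (\<lambda>y. A y $ 3) x,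
     partial 1 (\<lambda>y. A y $ 2) x - partial 2 (\<lambda>y. A y $ 1) x]"

definition grad_x :: "((real^3) \<times> (real^3) \<Rightarrow> real) \<Rightarrow> real^3 \<Rightarrow> real^3 \<Rightarrow> real^3" where
  "grad_x h x v = grad (\<lambda>y. h (y, v)) x"

definition grad_v :: "((real^3) \<times> (real^3) \<Rightarrow> real) \<Rightarrow> real^3 \<Rightarrow> real^3 \<Rightarrow> real^3" where
  "grad_v h x v = grad (\<lambda>w. h (x, w)) v"


section \<open>Background\<close>

record background =
  Omega :: "(real^3) set"
  n0 :: "real^3 \<Rightarrow> real"
  alpha :: real
  eps :: real
  vth :: real
  B0 :: "real^3"

definition valid_background :: "background \<Rightarrow> bool" where
  "valid_background P \<longleftrightarrow>
     open (Omega P) \<and> smooth_on (Omega P) (n0 P) \<and> (\<forall>x\<in>Omega P. n0 P x > 0) \<and>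
     alpha P \<noteq> 0 \<and> eps P \<noteq> 0 \<and> vth P > 0"

definition f0 :: "background \<Rightarrow> real^3 \<Rightarrow> real^3 \<Rightarrow> real" where
  "f0 P x v = n0 P x / (sqrt (2 * pi) * vth P) ^ 3 * exp (- (norm v)\<^sup>2 / (2 * (vth P)\<^sup>2))"

definition E0 :: "background \<Rightarrow> real^3 \<Rightarrow> real^3" where
  "E0 P x = ((vth P)\<^sup>2 * eps P) *\<^sub>R grad (\<lambda>y. ln (n0 P y)) x"

definition force :: "background \<Rightarrow> real^3 \<Rightarrow> real^3 \<Rightarrow> real^3" where
  "force P x v = E0 P x + cross3 v (B0 P)"

lemma grad_eqI:
  assumes "(h has_derivative (\<lambda>d. g \<bullet> d)) (at x)"
  shows "grad h x = g"
proof -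
  have "frechet_derivative h (at x) = (\<lambda>d. g \<bullet> d)"
    using frechet_derivative_at[OF assms] by simp
  then show ?thesis
    by (simp add: grad_def partial_def vec_eq_iff inner_axis)
qed

text \<open>The equilibrium condition holds identically, so it is not an extra hypothesis.\<close>

lemma equilibrium:
  assumes "valid_background P" "x \<in> Omega P"
  shows "v \<bullet> grad_x (\<lambda>(x, v). f0 P x v) x v
    + 1 / eps P * (force P x v \<bullet> grad_v (\<lambda>(x, v). f0 P x v) x v) = 0"
proof -
  from assms have pos: "n0 P x > 0" and e: "eps P \<noteq> 0" and t: "vth P > 0"
    and sm: "smooth_on (Omega P) (n0 P)" by (auto simp: valid_background_def)
  from sm have "n0 P differentiable (at x)" using assms(2) by (auto elim: smooth_on.cases)
  then obtain D where D: "(n0 P has_derivative D) (at x)" by (auto simp: differentiable_def)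
  define g where "g = (\<chi> i. D (axis i 1))"
  interpret D: linear D using D has_derivative_linear by blast
  have "D d = g \<bullet> d" for d
  proof -
    have "D d = D (\<Sum>i\<in>UNIV. (d $ i) *\<^sub>R axis i 1)"
      using basis_expansion[of d] by (simp add: scalar_mult_eq_scaleR)
    also have "\<dots> = g \<bullet> d"
      by (simp add: D.sum D.scaleR g_def inner_vec_def mult.commute)
    finally show ?thesis .
  qed
  then have Dg: "(n0 P has_derivative (\<lambda>d. g \<bullet> d)) (at x)" using D by (metis (no_types, lifting) ext)
  define c where "c = exp (- (norm v)\<^sup>2 / (2 * (vth P)\<^sup>2)) / (sqrt (2 * pi) * vth P) ^ 3"
  have f0: "f0 P y v = n0 P y * c" for y by (simp add: f0_def c_def)
  have 1: "grad_x (\<lambda>(x, v). f0 P x v) x v = c *\<^sub>R g"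
    unfolding grad_x_def f0 split
    by (rule grad_eqI) (auto intro!: derivative_eq_intros Dg simp: f0)
  have 2: "grad (\<lambda>y. ln (n0 P y)) x = (1 / n0 P x) *\<^sub>R g"
    by (rule grad_eqI) (use pos in \<open>auto intro!: derivative_eq_intros Dg simp: field_simps\<close>)
  have 3: "grad_v (\<lambda>(x, v). f0 P x v) x v = (- f0 P x v / (vth P)\<^sup>2) *\<^sub>R v"
    unfolding grad_v_def split
    apply (rule grad_eqI)
    unfolding f0_def power2_norm_eq_inner
    by (rule derivative_eq_intros refl | use t in \<open>simp add: fun_eq_iff inner_commute field_simps\<close>)+
  have "cross3 v (B0 P) \<bullet> v = 0" by (simp add: dot_cross_self inner_commute)
  then have "force P x v \<bullet> v = vth P ^2 * eps P / n0 P x * (g \<bullet> v)"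
    by (simp add: force_def E0_def 2 inner_add_left)
  then show ?thesis
    unfolding 1 3 using pos e t by (simp add: f0 inner_commute field_simps)
qed


section \<open>Triples of fields\<close>

text \<open>
  One type serves both for the states \<open>(f\<^sub>1, E\<^sub>1, B\<^sub>1)\<close> (and their variations) and for the functional
  derivatives \<open>(\<delta>F/\<delta>f\<^sub>1, \<delta>F/\<delta>E\<^sub>1, \<delta>F/\<delta>B\<^sub>1)\<close>.  A field on \<open>\<Omega>\<close> or \<open>\<Omega> \<times> \<real>\<^sup>3\<close> is represented by the
  total function that vanishes off that set.
\<close>

datatype fields = Fields
  (ph: "(real^3) \<times> (real^3) \<Rightarrow> real")
  (el: "real^3 \<Rightarrow> real^3")
  (mg: "real^3 \<Rightarrow> real^3")

instantiation fields :: real_vector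
begin

definition "0 = Fields (\<lambda>_. 0) (\<lambda>_. 0) (\<lambda>_. 0)"
definition "u + w = Fields (\<lambda>z. ph u z + ph w z) (\<lambda>x. el u x + el w x) (\<lambda>x. mg u x + mg w x)"
definition "- u = Fields (\<lambda>z. - ph u z) (\<lambda>x. - el u x) (\<lambda>x. - mg u x)"
definition "u - w = Fields (\<lambda>z. ph u z - ph w z) (\<lambda>x. el u x - el w x) (\<lambda>x. mg u x - mg w x)"
definition "c *\<^sub>R u = Fields (\<lambda>z. c * ph u z) (\<lambda>x. c *\<^sub>R el u x) (\<lambda>x. c *\<^sub>R mg u x)"

instance
  by standard
    (auto simp: zero_fields_def plus_fields_def uminus_fields_def minus_fields_def
      scaleR_fields_def fields.expand algebra_simps)

end

definition vanishes_off :: "(real^3) set \<Rightarrow> fields \<Rightarrow> bool" where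
  "vanishes_off S u \<longleftrightarrow>
     (\<forall>x v. x \<notin> S \<longrightarrow> ph u (x, v) = 0) \<and> (\<forall>x. x \<notin> S \<longrightarrow> el u x = 0 \<and> mg u x = 0)"

definition differentiable_fields :: "(real^3) set \<Rightarrow> fields \<Rightarrow> bool" where
  "differentiable_fields S u \<longleftrightarrow>
     (\<forall>x\<in>S. (\<forall>v. ph u differentiable (at (x, v))) \<and>
             el u differentiable (at x) \<and> mg u differentiable (at x))"

definition test_function ::
  "'a::euclidean_space set \<Rightarrow> ('a \<Rightarrow> 'b::real_normed_vector) \<Rightarrow> bool" where
  "test_function S \<phi> \<longleftrightarrow>
     smooth_on UNIV \<phi> \<and> (\<exists>K. compact K \<and> K \<subseteq> S \<and> (\<forall>x. x \<notin> K \<longrightarrow> \<phi> x = 0))"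

definition test_fields :: "(real^3) set \<Rightarrow> fields set" where
  "test_fields S =
     {u. test_function (S \<times> UNIV) (ph u) \<and> test_function S (el u) \<and> test_function S (mg u)}"

definition pairing :: "background \<Rightarrow> fields \<Rightarrow> fields \<Rightarrow> real" where
  "pairing P y w =
     (LINT z:Omega P \<times> UNIV|lborel. ph y z * ph w z) +
     (LINT x:Omega P|lborel. el y x \<bullet> el w x) +
     (LINT x:Omega P|lborel. mg y x \<bullet> mg w x)"

text \<open>
  The formal Hamiltonian vector field: integrating by parts, the bracket of two functionals with
  functional derivatives \<open>a\<close> and \<open>b\<close> is \<open>pairing P a (ham_op P b)\<close>.
\<close>

definition ham_op :: "background \<Rightarrow> fields \<Rightarrow> fields" where
  "ham_op P b = Fields
     (\<lambda>(x, v). if x \<in> Omega P then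
        1 / ((vth P)\<^sup>2 * eps P) * f0 P x v * (el b x \<bullet> v)
        - 1 / ((alpha P)\<^sup>2 * (vth P)\<^sup>2) * f0 P x v *
            (v \<bullet> grad_x (ph b) x v + 1 / eps P * (force P x v \<bullet> grad_v (ph b) x v))
      else 0)
     (\<lambda>x. if x \<in> Omega P then
        curl (mg b) x
        - (1 / ((vth P)\<^sup>2 * eps P)) *\<^sub>R (LINT v|lborel. (f0 P x v * ph b (x, v)) *\<^sub>R v)
      else 0)
     (\<lambda>x. if x \<in> Omega P then - curl (el b) x else 0)"


section \<open>Functional derivatives and smooth functionals\<close>

definition has_functional_derivative ::
  "background \<Rightarrow> fields set \<Rightarrow> (fields \<Rightarrow> real) \<Rightarrow> fields \<Rightarrow> fields \<Rightarrow> bool" where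
  "has_functional_derivative P X F u y \<longleftrightarrow>
     (\<forall>w\<in>X. ((\<lambda>s. F (u + s *\<^sub>R w)) has_real_derivative pairing P y w) (at 0))"

text \<open>
  Under the assumptions below the value of the bracket does not depend on the derivative chosen.
\<close>

definition functional_derivative ::
  "background \<Rightarrow> fields set \<Rightarrow> fields set \<Rightarrow> (fields \<Rightarrow> real) \<Rightarrow> fields \<Rightarrow> fields" where
  "functional_derivative P X Y F u = (SOME y. y \<in> Y \<and> has_functional_derivative P X F u y)"

definition topological_vector_space :: "'a::real_vector topology \<Rightarrow> bool" where
  "topological_vector_space T \<longleftrightarrow>
     subspace (topspace T) \<and>
     continuous_map (prod_topology T T) T (\<lambda>(u, w). u + w) \<and>
     continuous_map (prod_topology euclideanreal T) T (\<lambda>(c, u). c *\<^sub>R u)"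

text \<open>
  Smooth maps between topological vector spaces in the sense of Michal and Bastiani: all iterated
  directional derivatives exist, are multilinear in the directions, and are jointly continuous in the
  point and the directions.  \<open>D u [w\<^sub>k, \<dots>, w\<^sub>1]\<close> is the \<open>k\<close>-th derivative of \<open>g\<close> at \<open>u\<close> in the
  directions \<open>w\<^sub>1, \<dots>, w\<^sub>k\<close>.
\<close>

definition smooth_map ::
  "'a::real_vector topology \<Rightarrow> 'b::real_vector topology \<Rightarrow> ('a \<Rightarrow> 'b) \<Rightarrow> bool" where
  "smooth_map S T g \<longleftrightarrow> (\<exists>D :: 'a \<Rightarrow> 'a list \<Rightarrow> 'b.
     (\<forall>u\<in>topspace S. D u [] = g u) \<and>
     (\<forall>k. continuous_map (prod_topology S (product_topology (\<lambda>_. S) {..<k})) T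
            (\<lambda>(u, w). D u (map w [0..<k]))) \<and>
     (\<forall>u\<in>topspace S. \<forall>ps\<in>lists (topspace S). \<forall>qs\<in>lists (topspace S).
        \<forall>w\<in>topspace S. \<forall>w'\<in>topspace S. \<forall>c.
          D u (ps @ (w + c *\<^sub>R w') # qs) = D u (ps @ w # qs) + c *\<^sub>R D u (ps @ w' # qs)) \<and>
     (\<forall>u\<in>topspace S. \<forall>w\<in>topspace S. \<forall>ws\<in>lists (topspace S).
        limitin T (\<lambda>t. (1 / t) *\<^sub>R (D (u + t *\<^sub>R w) ws - D u ws)) (D u (w # ws)) (at 0)))"

text \<open>
  \<open>TX\<close> is the topological vector space of states and admissible variations, \<open>TY\<close> that of admissible
  functional derivatives.
\<close>

definition functionals ::
  "background \<Rightarrow> fields topology \<Rightarrow> fields topology \<Rightarrow> (fields \<Rightarrow> real) set" where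
  "functionals P TX TY = {F. smooth_map TX euclideanreal F \<and>
     (\<exists>g. smooth_map TX TY g \<and>
       (\<forall>u\<in>topspace TX. has_functional_derivative P (topspace TX) F u (g u)))}"

text \<open>
  The standing assumptions of the formal calculus, for an otherwise arbitrary choice of the two
  spaces.  Each assumption \<open>no_boundary_*\<close> says that the integral of a total divergence, namely of
  the one produced by an integration by parts in \<open>x\<close> or in \<open>v\<close>, is zero.
\<close>

locale admissible_spaces =
  fixes P :: background and TX TY :: "fields topology"
  assumes tvs_X: "topological_vector_space TX"
    and tvs_Y: "topological_vector_space TY"
    and off_X: "u \<in> topspace TX \<Longrightarrow> vanishes_off (Omega P) u"
    and off_Y: "y \<in> topspace TY \<Longrightarrow> vanishes_off (Omega P) y"
    and test_X: "test_fields (Omega P) \<subseteq> topspace TX"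
    and regular_Y: "y \<in> topspace TY \<Longrightarrow> differentiable_fields (Omega P) y"
    and pairing_integrable: "\<lbrakk>y \<in> topspace TY; w \<in> topspace TX\<rbrakk> \<Longrightarrow>
      set_integrable lborel (Omega P \<times> UNIV) (\<lambda>z. ph y z * ph w z) \<and>
      set_integrable lborel (Omega P) (\<lambda>x. el y x \<bullet> el w x) \<and>
      set_integrable lborel (Omega P) (\<lambda>x. mg y x \<bullet> mg w x)"
    and bracket_integrable: "\<lbrakk>a \<in> topspace TY; b \<in> topspace TY\<rbrakk> \<Longrightarrow>
      set_integrable lborel (Omega P) (\<lambda>x. curl (el a) x \<bullet> mg b x) \<and>
      set_integrable lborel (Omega P) (\<lambda>x. el a x \<bullet> curl (mg b) x) \<and>
      set_integrable lborel (Omega P \<times> UNIV) (\<lambda>(x, v). f0 P x v * (ph a (x, v) * (el b x \<bullet> v))) \<and>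
      set_integrable lborel (Omega P \<times> UNIV)
        (\<lambda>(x, v). f0 P x v * ((v \<bullet> grad_x (ph a) x v) * ph b (x, v))) \<and>
      set_integrable lborel (Omega P \<times> UNIV)
        (\<lambda>(x, v). f0 P x v * ((force P x v \<bullet> grad_v (ph a) x v) * ph b (x, v)))"
    and current_integrable: "\<lbrakk>b \<in> topspace TY; x \<in> Omega P\<rbrakk> \<Longrightarrow>
      integrable lborel (\<lambda>v. (f0 P x v * ph b (x, v)) *\<^sub>R v)"
    and no_boundary_EB: "\<lbrakk>a \<in> topspace TY; b \<in> topspace TY\<rbrakk> \<Longrightarrow>
      set_integrable lborel (Omega P) (divergence (\<lambda>x. cross3 (el a x) (mg b x))) \<and>
      (LINT x:Omega P|lborel. divergence (\<lambda>x. cross3 (el a x) (mg b x)) x) = 0"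
    and no_boundary_x: "\<lbrakk>a \<in> topspace TY; b \<in> topspace TY\<rbrakk> \<Longrightarrow>
      set_integrable lborel (Omega P \<times> UNIV)
        (\<lambda>(x, v). divergence (\<lambda>x. (f0 P x v * ph a (x, v) * ph b (x, v)) *\<^sub>R v) x) \<and>
      (LINT z:Omega P \<times> UNIV|lborel.
        (case z of (x, v) \<Rightarrow> divergence (\<lambda>x. (f0 P x v * ph a (x, v) * ph b (x, v)) *\<^sub>R v) x)) = 0"
    and no_boundary_v: "\<lbrakk>a \<in> topspace TY; b \<in> topspace TY\<rbrakk> \<Longrightarrow>
      set_integrable lborel (Omega P \<times> UNIV)
        (\<lambda>(x, v). divergence (\<lambda>v. (f0 P x v * ph a (x, v) * ph b (x, v)) *\<^sub>R force P x v) v) \<and>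
      (LINT z:Omega P \<times> UNIV|lborel.
        (case z of (x, v) \<Rightarrow>
          divergence (\<lambda>v. (f0 P x v * ph a (x, v) * ph b (x, v)) *\<^sub>R force P x v) v)) = 0"
    and pairing_continuous:
      "continuous_map (prod_topology TY TX) euclideanreal (\<lambda>(y, w). pairing P y w)"
    and ham_op_continuous: "continuous_map TY TX (ham_op P)"


section \<open>The bracket\<close>

text \<open>
  Here \<open>a\<close> and \<open>b\<close> are the functional derivatives of \<open>F\<close> and \<open>G\<close> at \<open>u\<close>.
\<close>

definition bracket ::
  "background \<Rightarrow> fields topology \<Rightarrow> fields topology \<Rightarrow>
   (fields \<Rightarrow> real) \<Rightarrow> (fields \<Rightarrow> real) \<Rightarrow> fields \<Rightarrow> real" where
  "bracket P TX TY F G u =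
    (let a = functional_derivative P (topspace TX) (topspace TY) F u;
         b = functional_derivative P (topspace TX) (topspace TY) G u
     in
       (LINT x:Omega P|lborel. curl (el a) x \<bullet> mg b x - mg a x \<bullet> curl (el b) x)
       + 1 / ((vth P)\<^sup>2 * eps P) *
         (LINT z:Omega P \<times> UNIV|lborel. (case z of (x, v) \<Rightarrow>
            (ph a (x, v) * (el b x \<bullet> v) - (el a x \<bullet> v) * ph b (x, v)) * f0 P x v))
       + 1 / 2 * (1 / ((alpha P)\<^sup>2 * (vth P)\<^sup>2)) *
         (LINT z:Omega P \<times> UNIV|lborel. (case z of (x, v) \<Rightarrow>
            f0 P x v *
            (v \<bullet> (ph b (x, v) *\<^sub>R grad_x (ph a) x v - ph a (x, v) *\<^sub>R grad_x (ph b) x v)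
             + 1 / eps P * (force P x v \<bullet>
                 (ph b (x, v) *\<^sub>R grad_v (ph a) x v - ph a (x, v) *\<^sub>R grad_v (ph b) x v))))))"

text \<open>
  A Poisson bracket on an algebra \<open>A\<close> of functions on \<open>X\<close>, with functions compared on \<open>X\<close>.
\<close>

definition poisson_bracket_on ::
  "'s set \<Rightarrow> ('s \<Rightarrow> real) set \<Rightarrow> (('s \<Rightarrow> real) \<Rightarrow> ('s \<Rightarrow> real) \<Rightarrow> 's \<Rightarrow> real) \<Rightarrow> bool" where
  "poisson_bracket_on X A br \<longleftrightarrow>
     (\<forall>F\<in>A. \<forall>G\<in>A. \<forall>c d. (\<lambda>u. c * F u + d * G u) \<in> A) \<and>
     (\<forall>F\<in>A. \<forall>G\<in>A. (\<lambda>u. F u * G u) \<in> A) \<and>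
     (\<forall>F\<in>A. \<forall>G\<in>A. br F G \<in> A) \<and>
     (\<forall>F\<in>A. \<forall>G\<in>A. \<forall>K\<in>A. \<forall>c d. \<forall>u\<in>X.
        br (\<lambda>u. c * F u + d * G u) K u = c * br F K u + d * br G K u \<and>
        br K (\<lambda>u. c * F u + d * G u) u = c * br K F u + d * br K G u) \<and>
     (\<forall>F\<in>A. \<forall>G\<in>A. \<forall>u\<in>X. br F G u = - br G F u) \<and>
     (\<forall>F\<in>A. \<forall>G\<in>A. \<forall>K\<in>A. \<forall>u\<in>X.
        br (\<lambda>u. F u * G u) K u = F u * br G K u + br F K u * G u) \<and>
     (\<forall>F\<in>A. \<forall>G\<in>A. \<forall>K\<in>A. \<forall>u\<in>X.
        br (br F G) K u + br (br K F) G u + br (br G K) F u = 0)"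

end

theory Submission
  imports Defs
begin

text \<open>
  Integrating by parts, the bracket of two functionals with functional derivatives \<open>a\<close> and \<open>b\<close> is
  \<open>pairing P a (ham_op P b)\<close>, where \<open>J = ham_op P\<close> is a continuous linear operator that does not
  depend on the state; the equilibrium condition makes the transport part of \<open>J\<close> antisymmetric.
  Hence \<open>{F, G}\<close> has the functional derivative
  \<open>F''(u) (J b) - G''(u) (J a)\<close> by the symmetry of the second derivatives, and the six terms of the
  Jacobi identity, such as \<open>\<langle>F''(u) (J b), J c\<rangle>\<close> with \<open>c\<close> the derivative of \<open>K\<close>, cancel in pairs.
\<close>

section \<open>Topological vector spaces\<close>

text \<open>The nested brackets can be computed only if \<open>{F, G}\<close> is again an admissible
  functional, so the bracket and its gradient must be shown smooth to all orders. The two spaces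
  carry no norm, only a vector space topology. Derivatives are therefore handled as explicit towers
  \<open>D u ws\<close>, and the towers of pairings and of terms such as \<open>F''(u) (J b)\<close>
  are written down by the Leibniz formula and checked clause by clause.

  Two further points shape the argument. A functional derivative is determined only through its
  pairings with variations, so the arbitrary choice hidden in \<open>bracket\<close> is harmless
  precisely because \<open>J\<close> maps admissible derivatives to admissible variations. And the
  symmetry of second derivatives is not a clause of \<open>smooth_map\<close>: it is derived from
  joint continuity by restricting to planes, for real-valued maps, and then transferred to gradients
  through the pairing.\<close>

lemma limitin_Pair:
  assumes "limitin S f a F" "limitin T g b F"
  shows "limitin (prod_topology S T) (\<lambda>x. (f x, g x)) (a, b) F"
  using assms by (simp add: limitin_pairwise o_def)

lemma limitin_compose:
  assumes "continuous_map S T h" "limitin S f a F"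
  shows "limitin T (\<lambda>x. h (f x)) (h a) F"
  using continuous_map_limit[OF assms] by (simp add: o_def)

lemma limitin_compose2:
  assumes "continuous_map (prod_topology S S') T (\<lambda>(x, y). h x y)"
    and "limitin S f a F" "limitin S' g b F"
  shows "limitin T (\<lambda>x. h (f x) (g x)) (h a b) F"
  using limitin_compose[OF assms(1) limitin_Pair[OF assms(2,3)]] by simp

lemma continuous_map_compose2:
  assumes "continuous_map (prod_topology S S') T (\<lambda>(x, y). h x y)"
    and "continuous_map X S f" "continuous_map X S' g"
  shows "continuous_map X T (\<lambda>x. h (f x) (g x))"
proof -
  have "continuous_map X (prod_topology S S') (\<lambda>x. (f x, g x))"
    using assms(2,3) by (simp add: continuous_map_pairwise o_def)
  from continuous_map_compose[OF this assms(1)] show ?thesis by (simp add: o_def)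
qed

context
  fixes T :: "'b::real_vector topology"
  assumes tvs: "topological_vector_space T"
begin

lemma tvs_subspace: "subspace (topspace T)"
  using tvs by (simp add: topological_vector_space_def)

lemma tvs_scaleR_mem: "u \<in> topspace T \<Longrightarrow> c *\<^sub>R u \<in> topspace T"
  by (rule subspace_scale[OF tvs_subspace])

lemma tvs_add_mem: "u \<in> topspace T \<Longrightarrow> w \<in> topspace T \<Longrightarrow> u + w \<in> topspace T"
  by (rule subspace_add[OF tvs_subspace])

lemma tvs_diff_mem: "u \<in> topspace T \<Longrightarrow> w \<in> topspace T \<Longrightarrow> u - w \<in> topspace T"
  by (rule subspace_diff[OF tvs_subspace])

lemma tvs_zero_mem: "0 \<in> topspace T"
  by (rule subspace_0[OF tvs_subspace])

lemma tvs_add_continuous: "continuous_map (prod_topology T T) T (\<lambda>(u, w). u + w)"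
  using tvs by (simp add: topological_vector_space_def)

lemma tvs_scaleR_continuous: "continuous_map (prod_topology euclideanreal T) T (\<lambda>(c, u). c *\<^sub>R u)"
  using tvs by (simp add: topological_vector_space_def)

lemmas continuous_map_tvs_add = continuous_map_compose2[OF tvs_add_continuous]
lemmas continuous_map_tvs_scaleR = continuous_map_compose2[OF tvs_scaleR_continuous]
lemmas limitin_tvs_add = limitin_compose2[OF tvs_add_continuous]
lemmas limitin_tvs_scaleR = limitin_compose2[OF tvs_scaleR_continuous]

lemma continuous_map_tvs_sum_list:
  "(\<And>p. p \<in> set ps \<Longrightarrow> continuous_map X T (f p)) \<Longrightarrow>
    continuous_map X T (\<lambda>x. \<Sum>p\<leftarrow>ps. f p x)"
proof (induction ps)
  case Nil
  show ?case by (simp add: tvs_zero_mem)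
next
  case (Cons p ps)
  then have "continuous_map X T (f p)" "continuous_map X T (\<lambda>x. \<Sum>p\<leftarrow>ps. f p x)" by simp_all
  from continuous_map_tvs_add[OF this] show ?case by simp
qed

lemma limitin_tvs_sum_list:
  "(\<And>p. p \<in> set ps \<Longrightarrow> limitin T (f p) (l p) F) \<Longrightarrow>
    limitin T (\<lambda>x. \<Sum>p\<leftarrow>ps. f p x) (\<Sum>p\<leftarrow>ps. l p) F"
proof (induction ps)
  case Nil
  show ?case by (simp add: tvs_zero_mem)
next
  case (Cons p ps)
  then have "limitin T (f p) (l p) F" "limitin T (\<lambda>x. \<Sum>p\<leftarrow>ps. f p x) (\<Sum>p\<leftarrow>ps. l p) F" by simp_all
  from limitin_tvs_add[OF this] show ?case by simp
qed

lemma continuous_map_tvs_line: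
  assumes "u \<in> topspace T" "w \<in> topspace T"
  shows "continuous_map euclideanreal T (\<lambda>t. u + t *\<^sub>R w)"
  by (intro continuous_map_tvs_add continuous_map_tvs_scaleR) (use assms in simp_all)

lemma limitin_tvs_line:
  assumes "u \<in> topspace T" "w \<in> topspace T"
  shows "limitin T (\<lambda>t. u + t *\<^sub>R w) u (at 0)"
proof -
  have "limitin euclideanreal (\<lambda>t::real. t) 0 (at 0)" by simp
  from limitin_compose[OF continuous_map_tvs_line[OF assms] this] show ?thesis by simp
qed

end

lemma topological_vector_space_euclideanreal: "topological_vector_space euclideanreal"
proof -
  have "continuous_map (prod_topology euclideanreal euclideanreal) euclideanreal (\<lambda>(u::real, w). u + w)"
    and "continuous_map (prod_topology euclideanreal euclideanreal) euclideanreal (\<lambda>(u::real, w). u *\<^sub>R w)"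
    by (auto simp: case_prod_unfold intro!: continuous_intros)
  then show ?thesis by (simp add: topological_vector_space_def)
qed


section \<open>Smooth maps\<close>

text \<open>The clauses of \<open>smooth_map\<close> that concern only the tower of iterated
  derivatives. Naming the tower allows new towers to be built from given ones; the map itself is
  read off as \<open>D u []\<close>.\<close>

definition smooth_derivs ::
  "'a::real_vector topology \<Rightarrow> 'b::real_vector topology \<Rightarrow> ('a \<Rightarrow> 'a list \<Rightarrow> 'b) \<Rightarrow> bool" where
  "smooth_derivs S T D \<longleftrightarrow>
     (\<forall>k. continuous_map (prod_topology S (product_topology (\<lambda>_. S) {..<k})) T
            (\<lambda>(u, w). D u (map w [0..<k]))) \<and>
     (\<forall>u\<in>topspace S. \<forall>ps\<in>lists (topspace S). \<forall>qs\<in>lists (topspace S).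
        \<forall>w\<in>topspace S. \<forall>w'\<in>topspace S. \<forall>c.
          D u (ps @ (w + c *\<^sub>R w') # qs) = D u (ps @ w # qs) + c *\<^sub>R D u (ps @ w' # qs)) \<and>
     (\<forall>u\<in>topspace S. \<forall>w\<in>topspace S. \<forall>ws\<in>lists (topspace S).
        limitin T (\<lambda>t. (1 / t) *\<^sub>R (D (u + t *\<^sub>R w) ws - D u ws)) (D u (w # ws)) (at 0))"

lemma smooth_map_iff:
  "smooth_map S T g \<longleftrightarrow> (\<exists>D. smooth_derivs S T D \<and> (\<forall>u\<in>topspace S. D u [] = g u))"
  unfolding smooth_map_def smooth_derivs_def by blast

lemma smooth_mapI:
  "smooth_derivs S T D \<Longrightarrow> (\<And>u. u \<in> topspace S \<Longrightarrow> D u [] = g u) \<Longrightarrow> smooth_map S T g"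
  unfolding smooth_map_iff by blast

lemma map_list_as_tuple: "map (\<lambda>i\<in>{..<length is}. w (is ! i)) [0..<length is] = map w is"
  by (rule nth_equalityI) auto

lemma continuous_map_list_tuple:
  assumes "\<And>i. i \<in> set is \<Longrightarrow> continuous_map X S (\<lambda>x. w x i)"
  shows "continuous_map X (product_topology (\<lambda>_. S) {..<length is})
           (\<lambda>x. \<lambda>i\<in>{..<length is}. w x (is ! i))"
  unfolding continuous_map_componentwise using assms by auto

text \<open>Continuity is restated for directions labelled by an arbitrary list \<open>is\<close>
  instead of tuples over \<open>{..<k}\<close>. Labels may be positions, so that a sublist of
  \<open>[0..<k]\<close> selects some of the directions, or the directions themselves with
  \<open>w x i = i\<close>, which keeps them constant.\<close>

lemma
  assumes D: "smooth_derivs S T D"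
  shows smooth_derivs_continuous:
      "\<lbrakk>continuous_map X S a; \<And>i. i \<in> set is \<Longrightarrow> continuous_map X S (\<lambda>x. w x i)\<rbrakk>
        \<Longrightarrow> continuous_map X T (\<lambda>x. D (a x) (map (w x) is))"
    and smooth_derivs_multilinear:
      "\<lbrakk>u \<in> topspace S; ps \<in> lists (topspace S); qs \<in> lists (topspace S);
        v \<in> topspace S; v' \<in> topspace S\<rbrakk> \<Longrightarrow>
          D u (ps @ (v + c *\<^sub>R v') # qs) = D u (ps @ v # qs) + c *\<^sub>R D u (ps @ v' # qs)"
    and smooth_derivs_limit:
      "\<lbrakk>u \<in> topspace S; v \<in> topspace S; ps \<in> lists (topspace S)\<rbrakk> \<Longrightarrow>
        limitin T (\<lambda>t. (1 / t) *\<^sub>R (D (u + t *\<^sub>R v) ps - D u ps)) (D u (v # ps)) (at 0)"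
proof -
  assume a: "continuous_map X S a" and w: "\<And>i. i \<in> set is \<Longrightarrow> continuous_map X S (\<lambda>x. w x i)"
  have "continuous_map (prod_topology S (product_topology (\<lambda>_. S) {..<length is})) T
            (\<lambda>(u, w). D u (map w [0..<length is]))"
    using D by (simp add: smooth_derivs_def)
  from continuous_map_compose2[OF this a continuous_map_list_tuple[where w = w, OF w]]
  show "continuous_map X T (\<lambda>x. D (a x) (map (w x) is))"
    by (simp add: map_list_as_tuple)
qed (use D in \<open>simp_all add: smooth_derivs_def\<close>)

text \<open>Continuity carries the typing: a continuous map sends one \<open>topspace\<close> into
  the other.\<close>

lemma smooth_derivs_mem:
  assumes "smooth_derivs S T D" "u \<in> topspace S" "ps \<in> lists (topspace S)"
  shows "D u ps \<in> topspace T"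
proof -
  have "continuous_map S T (\<lambda>x. D x (map (\<lambda>i. i) ps))"
    using assms by (intro smooth_derivs_continuous[OF assms(1)]) auto
  then show ?thesis using assms(2) by (auto simp: continuous_map_def)
qed

lemma smooth_derivs_continuous_point:
  assumes "smooth_derivs S T D" "ps \<in> lists (topspace S)"
  shows "continuous_map S T (\<lambda>u. D u ps)"
  using smooth_derivs_continuous[OF assms(1), of S "\<lambda>u. u" ps "\<lambda>_ i. i"] assms(2) by auto

text \<open>A continuous linear map commutes with difference quotients, so it acts on a tower entry
  by entry. Linearity is asked for on \<open>topspace T\<close> only, since \<open>ham_op P\<close>
  and the pairing with a fixed variation are known to be linear just on admissible fields.\<close>

lemma smooth_derivs_continuous_linear:
  assumes S: "topological_vector_space S" and T: "topological_vector_space T"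
    and J: "continuous_map T T' J"
    and lin: "\<And>a b c. a \<in> topspace T \<Longrightarrow> b \<in> topspace T \<Longrightarrow> J (a + c *\<^sub>R b) = J a + c *\<^sub>R J b"
    and D: "smooth_derivs S T D"
  shows "smooth_derivs S T' (\<lambda>u ws. J (D u ws))"
  unfolding smooth_derivs_def
proof (intro conjI allI ballI)
  fix k
  have "continuous_map (prod_topology S (product_topology (\<lambda>_. S) {..<k})) T
            (\<lambda>(u, w). D u (map w [0..<k]))"
    using D by (simp add: smooth_derivs_def)
  from continuous_map_compose[OF this J]
  show "continuous_map (prod_topology S (product_topology (\<lambda>_. S) {..<k})) T'
            (\<lambda>(u, w). J (D u (map w [0..<k])))"
    by (simp add: o_def case_prod_unfold)
next
  fix u ps qs w w' c
  assume *: "u \<in> topspace S" "ps \<in> lists (topspace S)" "qs \<in> lists (topspace S)"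
    "w \<in> topspace S" "w' \<in> topspace S"
  then show "J (D u (ps @ (w + c *\<^sub>R w') # qs)) = J (D u (ps @ w # qs)) + c *\<^sub>R J (D u (ps @ w' # qs))"
    by (subst smooth_derivs_multilinear[OF D]) (auto intro!: lin smooth_derivs_mem[OF D])
next
  fix u w ws
  assume *: "u \<in> topspace S" "w \<in> topspace S" "ws \<in> lists (topspace S)"
  \<comment> \<open>With both arguments zero and \<open>c = 1\<close>, linearity reads
    \<open>J 0 = J 0 + J 0\<close>.\<close>
  have J0: "J 0 = 0"
    using lin[of 0 0 1] tvs_zero_mem[OF T] by simp
  have eq: "J ((1 / t) *\<^sub>R (D (u + t *\<^sub>R w) ws - D u ws))
      = (1 / t) *\<^sub>R (J (D (u + t *\<^sub>R w) ws) - J (D u ws))" for t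
  proof -
    have m: "D (u + t *\<^sub>R w) ws \<in> topspace T" "D u ws \<in> topspace T"
      using * by (auto intro!: smooth_derivs_mem[OF D] tvs_add_mem[OF S] tvs_scaleR_mem[OF S])
    have "J (D (u + t *\<^sub>R w) ws + (-1) *\<^sub>R D u ws) = J (D (u + t *\<^sub>R w) ws) + (-1) *\<^sub>R J (D u ws)"
      by (rule lin[OF m])
    moreover have "J (0 + (1 / t) *\<^sub>R (D (u + t *\<^sub>R w) ws - D u ws))
      = J 0 + (1 / t) *\<^sub>R J (D (u + t *\<^sub>R w) ws - D u ws)"
      using m by (intro lin tvs_zero_mem[OF T] tvs_diff_mem[OF T])
    ultimately show ?thesis by (simp add: J0)
  qed
  from limitin_compose[OF J smooth_derivs_limit[OF D *]]
  show "limitin T' (\<lambda>t. (1 / t) *\<^sub>R (J (D (u + t *\<^sub>R w) ws) - J (D u ws))) (J (D u (w # ws))) (at 0)"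
    by (simp add: eq)
qed

section \<open>Leibniz sums over the distributions of directions between two factors\<close>

lemma sum_list_scaleR: "(\<Sum>x\<leftarrow>xs. c *\<^sub>R f x) = c *\<^sub>R (\<Sum>x\<leftarrow>xs. f x)"
  for f :: "'a \<Rightarrow> 'b::real_vector"
  by (induction xs) (simp_all add: scaleR_right_distrib)

text \<open>The index set of the Leibniz formula: every distribution of the entries between two
  factors, in their original order. A list of pairs, unlike a set, keeps multiplicities when
  directions coincide.\<close>

fun list_splits :: "'a list \<Rightarrow> ('a list \<times> 'a list) list" where
  "list_splits [] = [([], [])]"
| "list_splits (x # xs) =
    map (\<lambda>(p, q). (x # p, q)) (list_splits xs) @ map (\<lambda>(p, q). (p, x # q)) (list_splits xs)"

text \<open>Splitting depends on positions only. The sum over the splittings of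
  \<open>map w [0..<k]\<close> thus runs over a fixed finite list while \<open>w\<close> varies, and
  its continuity can be checked term by term.\<close>

lemma list_splits_map:
  "list_splits (map f xs) = map (\<lambda>(p, q). (map f p, map f q)) (list_splits xs)"
  by (induction xs) (auto simp: case_prod_unfold o_def)

lemma set_list_splits:
  "(p, q) \<in> set (list_splits xs) \<Longrightarrow> set p \<subseteq> set xs \<and> set q \<subseteq> set xs"
  by (induction xs arbitrary: p q) fastforce+

text \<open>The inductive form of the Leibniz formula: a further derivative, whose direction stands
  at the head, falls on one factor or on the other.\<close>

lemma sum_list_splits_Cons:
  fixes \<phi> :: "'a list \<Rightarrow> 'a list \<Rightarrow> 'b::real_vector"
  shows "(\<Sum>(p, q)\<leftarrow>list_splits (x # xs). \<phi> p q) =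
    (\<Sum>(p, q)\<leftarrow>list_splits xs. \<phi> (x # p) q + \<phi> p (x # q))"
  by (simp add: case_prod_unfold o_def sum_list_addf)

text \<open>Induction on the entries in front of the varied slot. The summand is generalized because
  removing \<open>x\<close> replaces \<open>\<phi> p q\<close> by
  \<open>\<phi> (x # p) q + \<phi> p (x # q)\<close>, which is again linear in every slot.\<close>

lemma sum_list_splits_multilinear:
  fixes \<phi> :: "'a::real_vector list \<Rightarrow> 'a list \<Rightarrow> 'b::real_vector"
  assumes "\<And>p1 p2 q. \<lbrakk>set p1 \<subseteq> A; set p2 \<subseteq> A; set q \<subseteq> A\<rbrakk> \<Longrightarrow>
      \<phi> (p1 @ (w + c *\<^sub>R w') # p2) q = \<phi> (p1 @ w # p2) q + c *\<^sub>R \<phi> (p1 @ w' # p2) q"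
    and "\<And>p q1 q2. \<lbrakk>set p \<subseteq> A; set q1 \<subseteq> A; set q2 \<subseteq> A\<rbrakk> \<Longrightarrow>
      \<phi> p (q1 @ (w + c *\<^sub>R w') # q2) = \<phi> p (q1 @ w # q2) + c *\<^sub>R \<phi> p (q1 @ w' # q2)"
    and "set ps \<subseteq> A" "set qs \<subseteq> A"
  shows "(\<Sum>(p, q)\<leftarrow>list_splits (ps @ (w + c *\<^sub>R w') # qs). \<phi> p q) =
      (\<Sum>(p, q)\<leftarrow>list_splits (ps @ w # qs). \<phi> p q)
      + c *\<^sub>R (\<Sum>(p, q)\<leftarrow>list_splits (ps @ w' # qs). \<phi> p q)"
  using assms
proof (induction ps arbitrary: \<phi>)
  case Nil
  have "(\<Sum>(p, q)\<leftarrow>list_splits qs. \<phi> ((w + c *\<^sub>R w') # p) q + \<phi> p ((w + c *\<^sub>R w') # q)) =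
     (\<Sum>(p, q)\<leftarrow>list_splits qs. (\<phi> (w # p) q + \<phi> p (w # q)) + c *\<^sub>R (\<phi> (w' # p) q + \<phi> p (w' # q)))"
  proof (intro arg_cong[where f=sum_list] map_cong refl, clarify)
    fix p q assume "(p, q) \<in> set (list_splits qs)"
    from set_list_splits[OF this] Nil(4) have "set p \<subseteq> A" "set q \<subseteq> A" by auto
    then show "\<phi> ((w + c *\<^sub>R w') # p) q + \<phi> p ((w + c *\<^sub>R w') # q) =
       (\<phi> (w # p) q + \<phi> p (w # q)) + c *\<^sub>R (\<phi> (w' # p) q + \<phi> p (w' # q))"
      using Nil(1)[of "[]" p q] Nil(2)[of p "[]" q] by (simp add: algebra_simps)
  qed
  also have "\<dots> = (\<Sum>(p, q)\<leftarrow>list_splits qs. \<phi> (w # p) q + \<phi> p (w # q))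
      + c *\<^sub>R (\<Sum>(p, q)\<leftarrow>list_splits qs. \<phi> (w' # p) q + \<phi> p (w' # q))"
    by (simp add: case_prod_unfold sum_list_addf sum_list_scaleR)
  finally show ?case unfolding append_Nil sum_list_splits_Cons .
next
  case (Cons x ps)
  have "(\<Sum>(p, q)\<leftarrow>list_splits (ps @ (w + c *\<^sub>R w') # qs). \<phi> (x # p) q + \<phi> p (x # q)) =
      (\<Sum>(p, q)\<leftarrow>list_splits (ps @ w # qs). \<phi> (x # p) q + \<phi> p (x # q))
      + c *\<^sub>R (\<Sum>(p, q)\<leftarrow>list_splits (ps @ w' # qs). \<phi> (x # p) q + \<phi> p (x # q))"
  proof (rule Cons.IH)
    show "set ps \<subseteq> A" "set qs \<subseteq> A" using Cons.prems by auto
    fix p1 p2 q assume "set p1 \<subseteq> A" "set p2 \<subseteq> A" "set q \<subseteq> A"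
    then show "\<phi> (x # p1 @ (w + c *\<^sub>R w') # p2) q + \<phi> (p1 @ (w + c *\<^sub>R w') # p2) (x # q) =
        \<phi> (x # p1 @ w # p2) q + \<phi> (p1 @ w # p2) (x # q)
        + c *\<^sub>R (\<phi> (x # p1 @ w' # p2) q + \<phi> (p1 @ w' # p2) (x # q))"
      using Cons.prems(1)[of "x # p1" p2 q] Cons.prems(1)[of p1 p2 "x # q"] Cons.prems(3)
      by (simp add: algebra_simps)
  next
    fix p q1 q2 assume "set p \<subseteq> A" "set q1 \<subseteq> A" "set q2 \<subseteq> A"
    then show "\<phi> (x # p) (q1 @ (w + c *\<^sub>R w') # q2) + \<phi> p (x # q1 @ (w + c *\<^sub>R w') # q2) =
        \<phi> (x # p) (q1 @ w # q2) + \<phi> p (x # q1 @ w # q2)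
        + c *\<^sub>R (\<phi> (x # p) (q1 @ w' # q2) + \<phi> p (x # q1 @ w' # q2))"
      using Cons.prems(2)[of "x # p" q1 q2] Cons.prems(2)[of p "x # q1" q2] Cons.prems(3)
      by (simp add: algebra_simps)
  qed
  then show ?case unfolding append_Cons sum_list_splits_Cons .
qed

text \<open>
  The common generalization of the product rule (\<open>M u ps z = B (D u ps) z\<close>) and of inserting a map
  into a slot of a derivative (\<open>M u ps z = D u (ps @ [z])\<close>).  Since \<open>M\<close> is linear in \<open>z\<close>, no mean
  value theorem is needed, and hence no local convexity.
\<close>

locale linear_family =
  fixes S :: "'a::real_vector topology" and Z :: "'c::real_vector topology"
    and T :: "'b::real_vector topology" and M :: "'a \<Rightarrow> 'a list \<Rightarrow> 'c \<Rightarrow> 'b"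
  assumes tvs_S: "topological_vector_space S"
    and tvs_Z: "topological_vector_space Z"
    and tvs_T: "topological_vector_space T"
    and continuous: "continuous_map
        (prod_topology (prod_topology S (product_topology (\<lambda>_. S) {..<k})) Z) T
        (\<lambda>((u, w), z). M u (map w [0..<k]) z)"
    and multilinear: "\<lbrakk>u \<in> topspace S; set ps \<subseteq> topspace S; set qs \<subseteq> topspace S;
        v \<in> topspace S; v' \<in> topspace S; z \<in> topspace Z\<rbrakk> \<Longrightarrow>
          M u (ps @ (v + c *\<^sub>R v') # qs) z = M u (ps @ v # qs) z + c *\<^sub>R M u (ps @ v' # qs) z"
    and linear: "\<lbrakk>u \<in> topspace S; set ps \<subseteq> topspace S; z \<in> topspace Z; z' \<in> topspace Z\<rbrakk> \<Longrightarrow>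
          M u ps (z + c *\<^sub>R z') = M u ps z + c *\<^sub>R M u ps z'"
    and limit: "\<lbrakk>u \<in> topspace S; v \<in> topspace S; set ps \<subseteq> topspace S; z \<in> topspace Z\<rbrakk> \<Longrightarrow>
        limitin T (\<lambda>t. (1 / t) *\<^sub>R (M (u + t *\<^sub>R v) ps z - M u ps z)) (M u (v # ps) z) (at 0)"

begin

lemma continuous_compose:
  assumes "continuous_map X S a" "\<And>i. i \<in> set is \<Longrightarrow> continuous_map X S (\<lambda>x. w x i)"
    and "continuous_map X Z c"
  shows "continuous_map X T (\<lambda>x. M (a x) (map (w x) is) (c x))"
proof -
  have 1: "continuous_map X (prod_topology S (product_topology (\<lambda>_. S) {..<length is}))
      (\<lambda>x. (a x, \<lambda>i\<in>{..<length is}. w x (is ! i)))"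
    using assms(1) continuous_map_list_tuple[where w = w, OF assms(2)]
    by (simp add: continuous_map_pairwise o_def)
  have 2: "continuous_map (prod_topology (prod_topology S (product_topology (\<lambda>_. S) {..<length is})) Z) T
      (\<lambda>(p, z). case p of (u, w) \<Rightarrow> M u (map w [0..<length is]) z)"
    using continuous[of "length is"] by (simp add: case_prod_unfold)
  from continuous_map_compose2[OF this 1 assms(3)] show ?thesis
    by (simp add: map_list_as_tuple)
qed

lemma mem:
  assumes "u \<in> topspace S" "set ps \<subseteq> topspace S" "z \<in> topspace Z"
  shows "M u ps z \<in> topspace T"
proof -
  have "continuous_map S T (\<lambda>x. M x (map (\<lambda>i. i) ps) z)"
    using assms by (intro continuous_compose) auto
  then show ?thesis using assms(1) by (auto simp: continuous_map_def)
qed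

lemma limit_compose:
  assumes "set ps \<subseteq> topspace S" "limitin S a u F" "limitin Z c z F"
  shows "limitin T (\<lambda>x. M (a x) ps (c x)) (M u ps z) F"
proof -
  have "continuous_map (prod_topology S Z) T (\<lambda>(x, y). M (fst (x, y)) (map (\<lambda>i. i) ps) (snd (x, y)))"
    unfolding case_prod_unfold
    using assms(1) by (intro continuous_compose) (auto simp: continuous_map_fst continuous_map_snd)
  then have "continuous_map (prod_topology S Z) T (\<lambda>(x, y). M x ps y)" by simp
  from limitin_compose2[OF this assms(2,3)] show ?thesis .
qed

lemma linear_diff:
  assumes "u \<in> topspace S" "set ps \<subseteq> topspace S" "z \<in> topspace Z" "z' \<in> topspace Z"
  shows "M u ps (c *\<^sub>R (z - z')) = c *\<^sub>R (M u ps z - M u ps z')"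
proof -
  note Z0 = tvs_zero_mem[OF tvs_Z]
  have 0: "M u ps 0 = 0" using linear[OF assms(1,2) Z0 Z0, of 1] by simp
  have "M u ps (z + (-1) *\<^sub>R z') = M u ps z + (-1) *\<^sub>R M u ps z'"
    by (rule linear[OF assms])
  moreover have "M u ps (0 + c *\<^sub>R (z - z')) = M u ps 0 + c *\<^sub>R M u ps (z - z')"
    using assms by (intro linear Z0 tvs_diff_mem[OF tvs_Z])
  ultimately show ?thesis by (simp add: 0)
qed

text \<open>The sum is the Leibniz formula for the map sending \<open>u\<close> to
  \<open>M u [] (Dh u [])\<close>. Each clause of \<open>smooth_derivs\<close> reduces to a
  statement about a single splitting.\<close>

lemma smooth_derivs_splits:
  assumes h: "smooth_derivs S Z Dh"
  shows "smooth_derivs S T (\<lambda>u ws. \<Sum>(p, q)\<leftarrow>list_splits ws. M u p (Dh u q))"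
  unfolding smooth_derivs_def
proof (intro conjI allI ballI)
  fix k :: nat
  let ?X = "prod_topology S (product_topology (\<lambda>_. S) {..<k})"
  have "continuous_map ?X T (\<lambda>x. \<Sum>pq\<leftarrow>list_splits [0..<k].
      M (fst x) (map (snd x) (fst pq)) (Dh (fst x) (map (snd x) (snd pq))))"
  proof (rule continuous_map_tvs_sum_list[OF tvs_T])
    fix pq assume pq: "pq \<in> set (list_splits [0..<k])"
    have base: "continuous_map ?X S fst" by (rule continuous_map_fst)
    have dir: "continuous_map ?X S (\<lambda>x. snd x i)" if "i < k" for i
      using continuous_map_compose[OF continuous_map_snd continuous_map_product_projection[of i "{..<k}" "\<lambda>_. S"]] that
      by (auto simp: o_def)
    have *: "\<And>i. i \<in> set (fst pq) \<Longrightarrow> i < k" "\<And>i. i \<in> set (snd pq) \<Longrightarrow> i < k"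
      using set_list_splits[of "fst pq" "snd pq" "[0..<k]"] pq by auto
    show "continuous_map ?X T
        (\<lambda>x. M (fst x) (map (snd x) (fst pq)) (Dh (fst x) (map (snd x) (snd pq))))"
      by (intro continuous_compose smooth_derivs_continuous[OF h] base dir *)
  qed
  then show "continuous_map ?X T
      (\<lambda>(u, w). \<Sum>(p, q)\<leftarrow>list_splits (map w [0..<k]). M u p (Dh u q))"
    by (simp add: list_splits_map case_prod_unfold o_def)
next
  fix u ps qs w w' c
  assume *: "u \<in> topspace S" "ps \<in> lists (topspace S)" "qs \<in> lists (topspace S)"
    "w \<in> topspace S" "w' \<in> topspace S"
  show "(\<Sum>(p, q)\<leftarrow>list_splits (ps @ (w + c *\<^sub>R w') # qs). M u p (Dh u q)) =
      (\<Sum>(p, q)\<leftarrow>list_splits (ps @ w # qs). M u p (Dh u q))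
      + c *\<^sub>R (\<Sum>(p, q)\<leftarrow>list_splits (ps @ w' # qs). M u p (Dh u q))"
  proof (rule sum_list_splits_multilinear[where A = "topspace S"])
    fix p q1 q2 assume "set p \<subseteq> topspace S" "set q1 \<subseteq> topspace S" "set q2 \<subseteq> topspace S"
    then show "M u p (Dh u (q1 @ (w + c *\<^sub>R w') # q2)) =
        M u p (Dh u (q1 @ w # q2)) + c *\<^sub>R M u p (Dh u (q1 @ w' # q2))"
      using * by (subst smooth_derivs_multilinear[OF h])
        (auto intro!: linear smooth_derivs_mem[OF h])
  qed (use * in \<open>auto intro!: multilinear smooth_derivs_mem[OF h]\<close>)
next
  fix u w ws
  assume *: "u \<in> topspace S" "w \<in> topspace S" "ws \<in> lists (topspace S)"
  have line: "u + t *\<^sub>R w \<in> topspace S" for t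
    using * by (intro tvs_add_mem tvs_scaleR_mem tvs_S)
  have "limitin T (\<lambda>t. \<Sum>pq\<leftarrow>list_splits ws. (1 / t) *\<^sub>R
        (M (u + t *\<^sub>R w) (fst pq) (Dh (u + t *\<^sub>R w) (snd pq)) - M u (fst pq) (Dh u (snd pq))))
      (\<Sum>pq\<leftarrow>list_splits ws. M u (w # fst pq) (Dh u (snd pq)) + M u (fst pq) (Dh u (w # snd pq))) (at 0)"
  proof (rule limitin_tvs_sum_list[OF tvs_T])
    fix pq assume pq: "pq \<in> set (list_splits ws)"
    have p: "set (fst pq) \<subseteq> topspace S" and q: "snd pq \<in> lists (topspace S)"
      using set_list_splits[of "fst pq" "snd pq" ws] pq * by auto
    let ?D = "\<lambda>t. Dh (u + t *\<^sub>R w) (snd pq)"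
    have m: "?D t \<in> topspace Z" "Dh u (snd pq) \<in> topspace Z" for t
      by (intro smooth_derivs_mem[OF h] line * q)+
    \<comment> \<open>The increment is split by adding and subtracting the value of \<open>M\<close>
      at the moved point on the old argument. In the second part, linearity carries the factor
      \<open>1 / t\<close> into the argument, and joint continuity gives the limit although the base
      point moves as well.\<close>
    have "limitin T (\<lambda>t. (1 / t) *\<^sub>R (M (u + t *\<^sub>R w) (fst pq) (Dh u (snd pq)) - M u (fst pq) (Dh u (snd pq)))
        + M (u + t *\<^sub>R w) (fst pq) ((1 / t) *\<^sub>R (?D t - Dh u (snd pq))))
      (M u (w # fst pq) (Dh u (snd pq)) + M u (fst pq) (Dh u (w # snd pq))) (at 0)"
      by (intro limitin_tvs_add[OF tvs_T] limit limit_compose smooth_derivs_limit[OF h]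
          limitin_tvs_line[OF tvs_S] * p q m)
    then show "limitin T (\<lambda>t. (1 / t) *\<^sub>R (M (u + t *\<^sub>R w) (fst pq) (?D t) - M u (fst pq) (Dh u (snd pq))))
      (M u (w # fst pq) (Dh u (snd pq)) + M u (fst pq) (Dh u (w # snd pq))) (at 0)"
      using linear_diff[OF line p m] by (simp add: algebra_simps)
  qed
  then show "limitin T (\<lambda>t. (1 / t) *\<^sub>R
        ((\<Sum>(p, q)\<leftarrow>list_splits ws. M (u + t *\<^sub>R w) p (Dh (u + t *\<^sub>R w) q))
          - (\<Sum>(p, q)\<leftarrow>list_splits ws. M u p (Dh u q))))
      (\<Sum>(p, q)\<leftarrow>list_splits (w # ws). M u p (Dh u q)) (at 0)"
    unfolding sum_list_splits_Cons
    by (simp add: case_prod_unfold sum_list_scaleR sum_list_subtractf)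
qed

end

text \<open>For fixed \<open>z\<close> the map \<open>B _ z\<close> is continuous and linear, which
  turns the limits of \<open>D\<close> into those required of a \<open>linear_family\<close>. The
  main use is the pairing of one gradient with the Hamiltonian vector field of another.\<close>

lemma smooth_derivs_bilinear:
  assumes "topological_vector_space S" "topological_vector_space Y" "topological_vector_space Z"
    "topological_vector_space T"
    and B: "continuous_map (prod_topology Y Z) T (\<lambda>(y, z). B y z)"
    and lin1: "\<And>y y' z c. \<lbrakk>y \<in> topspace Y; y' \<in> topspace Y; z \<in> topspace Z\<rbrakk> \<Longrightarrow>
        B (y + c *\<^sub>R y') z = B y z + c *\<^sub>R B y' z"
    and lin2: "\<And>y z z' c. \<lbrakk>y \<in> topspace Y; z \<in> topspace Z; z' \<in> topspace Z\<rbrakk> \<Longrightarrow>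
        B y (z + c *\<^sub>R z') = B y z + c *\<^sub>R B y z'"
    and D: "smooth_derivs S Y D" and D': "smooth_derivs S Z D'"
  shows "smooth_derivs S T (\<lambda>u ws. \<Sum>(p, q)\<leftarrow>list_splits ws. B (D u p) (D' u q))"
proof -
  note mem = smooth_derivs_mem[OF D]
  interpret linear_family S Z T "\<lambda>u ps z. B (D u ps) z"
  proof
    fix k
    have "continuous_map (prod_topology S (product_topology (\<lambda>_. S) {..<k})) Y
            (\<lambda>(u, w). D u (map w [0..<k]))"
      using D by (simp add: smooth_derivs_def)
    note 1 = continuous_map_compose[OF continuous_map_fst this, of Z]
    show "continuous_map (prod_topology (prod_topology S (product_topology (\<lambda>_. S) {..<k})) Z) T
        (\<lambda>((u, w), z). B (D u (map w [0..<k])) z)"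
      using continuous_map_compose2[OF B 1 continuous_map_snd]
      by (simp add: case_prod_unfold o_def)
  next
    fix u v ps z assume *: "u \<in> topspace S" "v \<in> topspace S" "set ps \<subseteq> topspace S" "z \<in> topspace Z"
    have cont: "continuous_map Y T (\<lambda>y. B y z)"
      using continuous_map_compose2[OF B, of Y "\<lambda>y. y" "\<lambda>_. z"] * by simp
    have ps: "ps \<in> lists (topspace S)" using * by auto
    have diff: "B (c *\<^sub>R (y - y')) z = c *\<^sub>R (B y z - B y' z)" if "y \<in> topspace Y" "y' \<in> topspace Y" for c y y'
    proof -
      note Y0 = tvs_zero_mem[OF assms(2)]
      have "B 0 z = 0" using lin1[OF Y0 Y0 *(4), of 1] by simp
      moreover have "B (y + (-1) *\<^sub>R y') z = B y z + (-1) *\<^sub>R B y' z" by (intro lin1 that *)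
      moreover have "B (0 + c *\<^sub>R (y - y')) z = B 0 z + c *\<^sub>R B (y - y') z"
        by (intro lin1 * Y0 tvs_diff_mem[OF assms(2)] that)
      ultimately show ?thesis by simp
    qed
    have "B ((1 / t) *\<^sub>R (D (u + t *\<^sub>R v) ps - D u ps)) z = (1 / t) *\<^sub>R (B (D (u + t *\<^sub>R v) ps) z - B (D u ps) z)" for t
      by (intro diff mem tvs_add_mem[OF assms(1)] tvs_scaleR_mem[OF assms(1)] * ps)
    with limitin_compose[OF cont smooth_derivs_limit[OF D *(1,2) ps]]
    show "limitin T (\<lambda>t. (1 / t) *\<^sub>R (B (D (u + t *\<^sub>R v) ps) z - B (D u ps) z)) (B (D u (v # ps)) z) (at 0)"
      by simp
  next
    fix u ps qs v v' z c
    assume *: "u \<in> topspace S" "set ps \<subseteq> topspace S" "set qs \<subseteq> topspace S"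
        "v \<in> topspace S" "v' \<in> topspace S" "z \<in> topspace Z"
    then show "B (D u (ps @ (v + c *\<^sub>R v') # qs)) z = B (D u (ps @ v # qs)) z + c *\<^sub>R B (D u (ps @ v' # qs)) z"
      by (subst smooth_derivs_multilinear[OF D]) (auto intro!: lin1 mem)
  qed (use assms in \<open>auto intro!: lin2 mem\<close>)
  show ?thesis by (rule smooth_derivs_splits[OF D'])
qed

text \<open>Both terms in the gradient of a bracket have the form \<open>D u [h u]\<close>. The
  inserted value stands at the end because later directions are added at the head, so its slot stays
  in place under further differentiation.\<close>

lemma smooth_derivs_insert:
  assumes "topological_vector_space S" "topological_vector_space T"
    and D: "smooth_derivs S T D" and h: "smooth_derivs S S Dh"
  shows "smooth_derivs S T (\<lambda>u ws. \<Sum>(p, q)\<leftarrow>list_splits ws. D u (p @ [Dh u q]))"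
proof -
  interpret linear_family S S T "\<lambda>u ps z. D u (ps @ [z])"
  proof
    fix k :: nat
    let ?X = "prod_topology (prod_topology S (product_topology (\<lambda>_. S) {..<k})) S"
    \<comment> \<open>The inserted vector is treated as one more direction, at position
      \<open>k\<close> of a tuple of length \<open>Suc k\<close>.\<close>
    have "continuous_map ?X T
      (\<lambda>x. D (fst (fst x)) (map (\<lambda>i. if i < k then snd (fst x) i else snd x) [0..<Suc k]))"
    proof (rule smooth_derivs_continuous[OF D])
      show "continuous_map ?X S (\<lambda>x. fst (fst x))"
        by (intro continuous_map_of_fst continuous_map_fst continuous_map_compose[unfolded o_def, OF continuous_map_fst])
      fix i
      have "continuous_map ?X S (\<lambda>x. snd (fst x) i)" if "i < k"
        using continuous_map_compose[OF continuous_map_compose[OF continuous_map_fst continuous_map_snd]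
            continuous_map_product_projection[of i "{..<k}" "\<lambda>_. S"]] that
        by (auto simp: o_def)
      then show "continuous_map ?X S (\<lambda>x. if i < k then snd (fst x) i else snd x)"
        by (cases "i < k") (auto simp: continuous_map_snd)
    qed
    moreover have "map (\<lambda>i. if i < k then w i else z) [0..<Suc k] = map w [0..<k] @ [z]"
      for w :: "nat \<Rightarrow> 'a" and z by simp
    ultimately show "continuous_map ?X T (\<lambda>((u, w), z). D u (map w [0..<k] @ [z]))"
      by (simp add: case_prod_unfold del: upt_Suc)
  next
    fix u ps z z' c
    assume "u \<in> topspace S" "set ps \<subseteq> topspace S" "z \<in> topspace S" "z' \<in> topspace S"
    then show "D u (ps @ [z + c *\<^sub>R z']) = D u (ps @ [z]) + c *\<^sub>R D u (ps @ [z'])"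
      using smooth_derivs_multilinear[OF D, of u ps "[]" z z' c] by (auto simp: lists_eq_set)
  next
    fix u ps qs v v' z c
    assume "u \<in> topspace S" "set ps \<subseteq> topspace S" "set qs \<subseteq> topspace S"
        "v \<in> topspace S" "v' \<in> topspace S" "z \<in> topspace S"
    then show "D u ((ps @ (v + c *\<^sub>R v') # qs) @ [z]) = D u ((ps @ v # qs) @ [z]) + c *\<^sub>R D u ((ps @ v' # qs) @ [z])"
      using smooth_derivs_multilinear[OF D, of u ps "qs @ [z]" v v' c] by auto
  next
    fix u v ps z
    assume "u \<in> topspace S" "v \<in> topspace S" "set ps \<subseteq> topspace S" "z \<in> topspace S"
    then show "limitin T (\<lambda>t. (1 / t) *\<^sub>R (D (u + t *\<^sub>R v) (ps @ [z]) - D u (ps @ [z])))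
        (D u ((v # ps) @ [z])) (at 0)"
      using smooth_derivs_limit[OF D, of u v "ps @ [z]"] by auto
  qed (use assms in auto)
  show ?thesis by (rule smooth_derivs_splits[OF h])
qed

lemma smooth_derivs_lincomb:
  assumes T: "topological_vector_space T"
    and D: "smooth_derivs S T D" and D': "smooth_derivs S T D'"
  shows "smooth_derivs S T (\<lambda>u ws. c *\<^sub>R D u ws + d *\<^sub>R D' u ws)"
  unfolding smooth_derivs_def
proof (intro conjI allI ballI)
  note lincomb = continuous_map_tvs_add[OF T continuous_map_tvs_scaleR[OF T] continuous_map_tvs_scaleR[OF T]]
  fix k
  show "continuous_map (prod_topology S (product_topology (\<lambda>_. S) {..<k})) T
      (\<lambda>(u, w). c *\<^sub>R D u (map w [0..<k]) + d *\<^sub>R D' u (map w [0..<k]))"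
    using D D' unfolding smooth_derivs_def case_prod_unfold by (intro lincomb) auto
next
  fix u ps qs w w' e
  assume "u \<in> topspace S" "ps \<in> lists (topspace S)" "qs \<in> lists (topspace S)"
    "w \<in> topspace S" "w' \<in> topspace S"
  then show "c *\<^sub>R D u (ps @ (w + e *\<^sub>R w') # qs) + d *\<^sub>R D' u (ps @ (w + e *\<^sub>R w') # qs) =
      c *\<^sub>R D u (ps @ w # qs) + d *\<^sub>R D' u (ps @ w # qs)
      + e *\<^sub>R (c *\<^sub>R D u (ps @ w' # qs) + d *\<^sub>R D' u (ps @ w' # qs))"
    by (simp add: smooth_derivs_multilinear[OF D] smooth_derivs_multilinear[OF D'] algebra_simps)
next
  fix u w ws assume *: "u \<in> topspace S" "w \<in> topspace S" "ws \<in> lists (topspace S)"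
  have "limitin T (\<lambda>t. c *\<^sub>R ((1 / t) *\<^sub>R (D (u + t *\<^sub>R w) ws - D u ws))
      + d *\<^sub>R ((1 / t) *\<^sub>R (D' (u + t *\<^sub>R w) ws - D' u ws)))
      (c *\<^sub>R D u (w # ws) + d *\<^sub>R D' u (w # ws)) (at 0)"
    by (intro limitin_tvs_add[OF T] limitin_tvs_scaleR[OF T] smooth_derivs_limit[OF D *]
        smooth_derivs_limit[OF D' *]) auto
  then show "limitin T (\<lambda>t. (1 / t) *\<^sub>R (c *\<^sub>R D (u + t *\<^sub>R w) ws + d *\<^sub>R D' (u + t *\<^sub>R w) ws
        - (c *\<^sub>R D u ws + d *\<^sub>R D' u ws)))
      (c *\<^sub>R D u (w # ws) + d *\<^sub>R D' u (w # ws)) (at 0)"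
    by (simp add: algebra_simps)
qed

lemma smooth_map_lincomb:
  assumes "topological_vector_space T" "smooth_map S T f" "smooth_map S T g"
  shows "smooth_map S T (\<lambda>u. c *\<^sub>R f u + d *\<^sub>R g u)"
proof -
  from assms(2,3) obtain D D' where D: "smooth_derivs S T D" "smooth_derivs S T D'"
    and "\<forall>u\<in>topspace S. D u [] = f u" "\<forall>u\<in>topspace S. D' u [] = g u"
    unfolding smooth_map_iff by blast
  then show ?thesis
    by (intro smooth_mapI[OF smooth_derivs_lincomb[OF assms(1) D]]) auto
qed

lemma smooth_map_bilinear:
  assumes "topological_vector_space S" "topological_vector_space Y" "topological_vector_space Z"
    "topological_vector_space T"
    and "continuous_map (prod_topology Y Z) T (\<lambda>(y, z). B y z)"
    and "\<And>y y' z c. \<lbrakk>y \<in> topspace Y; y' \<in> topspace Y; z \<in> topspace Z\<rbrakk> \<Longrightarrow>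
        B (y + c *\<^sub>R y') z = B y z + c *\<^sub>R B y' z"
    and "\<And>y z z' c. \<lbrakk>y \<in> topspace Y; z \<in> topspace Z; z' \<in> topspace Z\<rbrakk> \<Longrightarrow>
        B y (z + c *\<^sub>R z') = B y z + c *\<^sub>R B y z'"
    and f: "smooth_map S Y f" and g: "smooth_map S Z g"
  shows "smooth_map S T (\<lambda>u. B (f u) (g u))"
proof -
  from f g obtain D D' where D: "smooth_derivs S Y D" "smooth_derivs S Z D'"
    and "\<forall>u\<in>topspace S. D u [] = f u" "\<forall>u\<in>topspace S. D' u [] = g u"
    unfolding smooth_map_iff by blast
  then show ?thesis
    by (intro smooth_mapI[OF smooth_derivs_bilinear[OF assms(1-7) D]]) auto
qed

lemma smooth_map_scaleR:
  assumes "topological_vector_space S" "topological_vector_space T"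
    and "smooth_map S euclideanreal f" "smooth_map S T g"
  shows "smooth_map S T (\<lambda>u. f u *\<^sub>R g u)"
  by (rule smooth_map_bilinear[OF assms(1) topological_vector_space_euclideanreal assms(2,2)
        tvs_scaleR_continuous[OF assms(2)] _ _ assms(3,4)])
    (simp_all add: algebra_simps)

section \<open>Symmetry of second derivatives\<close>

lemma smooth_derivs_has_derivative:
  assumes S: "topological_vector_space S" and D: "smooth_derivs S euclideanreal D"
    and "u \<in> topspace S" "w \<in> topspace S" "ws \<in> lists (topspace S)"
  shows "((\<lambda>t. D (u + t *\<^sub>R w) ws) has_real_derivative D (u + t *\<^sub>R w) (w # ws)) (at t)"
proof -
  \<comment> \<open>The domain is a whole subspace, so every point of the line can serve as base
    point of the limit clause.\<close>
  have "u + t *\<^sub>R w \<in> topspace S"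
    by (intro tvs_add_mem[OF S] tvs_scaleR_mem[OF S] assms)
  from smooth_derivs_limit[OF D this assms(4,5)]
  have "(\<lambda>h. (D (u + t *\<^sub>R w + h *\<^sub>R w) ws - D (u + t *\<^sub>R w) ws) / h) \<midarrow>0\<rightarrow> D (u + t *\<^sub>R w) (w # ws)"
    by simp
  then show ?thesis by (simp add: DERIV_def algebra_simps)
qed

text \<open>The mean value theorem is used twice: in \<open>s\<close> for
  \<open>f s h - f s 0\<close>, then in \<open>t\<close> for \<open>dfs x\<close>.\<close>

lemma double_difference_mean_value:
  fixes f dfs dfst :: "real \<Rightarrow> real \<Rightarrow> real"
  assumes "\<And>s t. ((\<lambda>s. f s t) has_real_derivative dfs s t) (at s)"
    and "\<And>s t. ((\<lambda>t. dfs s t) has_real_derivative dfst s t) (at t)"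
    and "h > 0"
  obtains x y where "0 < x" "x < h" "0 < y" "y < h"
    and "f h h - f h 0 - f 0 h + f 0 0 = h * h * dfst x y"
proof -
  have "((\<lambda>s. f s h - f s 0) has_real_derivative dfs s h - dfs s 0) (at s)" for s
    by (intro DERIV_diff assms)
  from MVT2[OF \<open>h > 0\<close> this]
  obtain x where x: "0 < x" "x < h" "(f h h - f h 0) - (f 0 h - f 0 0) = h * (dfs x h - dfs x 0)" by auto
  from MVT2[OF \<open>h > 0\<close> assms(2)]
  obtain y where y: "0 < y" "y < h" "dfs x h - dfs x 0 = h * dfst x y" by auto
  show ?thesis using that[OF x(1,2) y(1,2)] x(3) y(3) by simp
qed

text \<open>Schwarz's theorem. The double difference over a small square equals \<open>h * h\<close>
  times either mixed partial at some point of the square, and continuity at the origin forces the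
  two values there to agree.\<close>

lemma mixed_partials_eq:
  fixes f dfs dft dfst dfts :: "real \<Rightarrow> real \<Rightarrow> real"
  assumes dfs: "\<And>s t. ((\<lambda>s. f s t) has_real_derivative dfs s t) (at s)"
    and dft: "\<And>s t. ((\<lambda>t. f s t) has_real_derivative dft s t) (at t)"
    and dfst: "\<And>s t. ((\<lambda>t. dfs s t) has_real_derivative dfst s t) (at t)"
    and dfts: "\<And>s t. ((\<lambda>s. dft s t) has_real_derivative dfts s t) (at s)"
    and cont: "isCont (\<lambda>(s, t). dfst s t) (0, 0)" "isCont (\<lambda>(s, t). dfts s t) (0, 0)"
  shows "dfst 0 0 = dfts 0 0"
proof (rule ccontr)
  assume ne: "dfst 0 0 \<noteq> dfts 0 0"
  \<comment> \<open>Half of the supposed gap: a number cannot lie within \<open>e\<close> of both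
    values.\<close>
  define e where "e = \<bar>dfst 0 0 - dfts 0 0\<bar> / 2"
  have "e > 0" using ne by (simp add: e_def)
  obtain d1 where d1: "d1 > 0" "\<And>s t. dist (s, t) (0, 0) < d1 \<Longrightarrow> dist (dfst s t) (dfst 0 0) < e"
    using cont(1)[unfolded continuous_at_eps_delta, rule_format, OF \<open>e > 0\<close>] by (auto simp: split_paired_all)
  obtain d2 where d2: "d2 > 0" "\<And>s t. dist (s, t) (0, 0) < d2 \<Longrightarrow> dist (dfts s t) (dfts 0 0) < e"
    using cont(2)[unfolded continuous_at_eps_delta, rule_format, OF \<open>e > 0\<close>] by (auto simp: split_paired_all)
  \<comment> \<open>Points of the open square have norm below \<open>2 * h\<close>, so halving puts
    the square into both balls.\<close>
  define h where "h = min d1 d2 / 2"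
  have h: "h > 0" "2 * h \<le> d1" "2 * h \<le> d2" using d1(1) d2(1) by (auto simp: h_def)
  have small: "dist (s, t) (0, 0) < 2 * h" if "0 < s" "s < h" "0 < t" "t < h" for s t :: real
    using that norm_Pair_le[of s t] by (simp add: dist_norm)
  obtain x y where x: "0 < x" "x < h" "0 < y" "y < h"
    and 1: "f h h - f h 0 - f 0 h + f 0 0 = h * h * dfst x y"
    using double_difference_mean_value[of f dfs dfst h] dfs dfst h by blast
  \<comment> \<open>The roles of \<open>s\<close> and \<open>t\<close> are exchanged here, so the
    point found is \<open>(y', x')\<close>.\<close>
  obtain x' y' where x': "0 < x'" "x' < h" "0 < y'" "y' < h"
    and 2: "f h h - f 0 h - f h 0 + f 0 0 = h * h * dfts y' x'"
    using double_difference_mean_value[of "\<lambda>t s. f s t" "\<lambda>t s. dft s t" "\<lambda>t s. dfts s t" h] dft dfts h by blast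
  have "h * h * dfst x y = h * h * dfts y' x'" using 1 2 by linarith
  then have "dfst x y = dfts y' x'" using h by simp
  moreover have "dist (dfst x y) (dfst 0 0) < e" using small[OF x] h by (intro d1) simp
  moreover have "dist (dfts y' x') (dfts 0 0) < e" using small[OF x'(3,4,1,2)] h by (intro d2) simp
  ultimately show False unfolding dist_real_def e_def by (smt (verit) field_sum_of_halves)
qed

text \<open>On the plane through \<open>u\<close> spanned by \<open>v\<close> and \<open>w\<close>
  this is a statement about functions of two real variables. The head of the list is the direction
  differentiated last, so \<open>[w, v]\<close> is the \<open>t\<close>-derivative of the
  \<open>s\<close>-derivative.\<close>

lemma smooth_derivs_symmetric:
  assumes S: "topological_vector_space S" and D: "smooth_derivs S euclideanreal D"
    and u: "u \<in> topspace S" and v: "v \<in> topspace S" and w: "w \<in> topspace S"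
  shows "D u [v, w] = D u [w, v]"
proof -
  define q where "q s t = u + s *\<^sub>R v + t *\<^sub>R w" for s t :: real
  have q: "q s t = (u + t *\<^sub>R w) + s *\<^sub>R v" "q s t = (u + s *\<^sub>R v) + t *\<^sub>R w" for s t
    by (simp_all add: q_def algebra_simps)
  have mem: "u + s *\<^sub>R v \<in> topspace S" "u + t *\<^sub>R w \<in> topspace S" for s t
    by (intro tvs_add_mem[OF S] tvs_scaleR_mem[OF S] u v w)+
  note deriv = smooth_derivs_has_derivative[OF S D]
  have "continuous_map euclidean S (\<lambda>z. q (fst z) (snd z))"
    unfolding q_def using u v w
    by (intro continuous_map_tvs_add[OF S] continuous_map_tvs_scaleR[OF S])
      (auto intro!: continuous_intros)
  from continuous_map_compose[OF this smooth_derivs_continuous_point[OF D]]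
  have cont: "isCont (\<lambda>(s, t). D (q s t) ps) (0, 0)" if "set ps \<subseteq> topspace S" for ps
    using that by (auto simp: o_def case_prod_unfold continuous_on_eq_continuous_at)
  have "D (q 0 0) [w, v] = D (q 0 0) [v, w]"
  proof (rule mixed_partials_eq[where f = "\<lambda>s t. D (q s t) []" and dfs = "\<lambda>s t. D (q s t) [v]"
        and dft = "\<lambda>s t. D (q s t) [w]" and dfst = "\<lambda>s t. D (q s t) [w, v]"
        and dfts = "\<lambda>s t. D (q s t) [v, w]"])
    show "((\<lambda>s. D (q s t) []) has_real_derivative D (q s t) [v]) (at s)"
      "((\<lambda>s. D (q s t) [w]) has_real_derivative D (q s t) [v, w]) (at s)" for s t
      unfolding q(1) using v w by (intro deriv mem; simp)+
    show "((\<lambda>t. D (q s t) []) has_real_derivative D (q s t) [w]) (at t)"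
      "((\<lambda>t. D (q s t) [v]) has_real_derivative D (q s t) [w, v]) (at t)" for s t
      unfolding q(2) using v w by (intro deriv mem; simp)+
  qed (use v w in \<open>auto intro!: cont\<close>)
  then show ?thesis by (simp add: q_def)
qed


section \<open>Vector calculus\<close>

lemma partial_eqI: "(h has_derivative D) (at x) \<Longrightarrow> partial i h x = D (axis i 1)"
  unfolding partial_def by (metis frechet_derivative_at)

lemma partial_has_derivative:
  "h differentiable (at x) \<Longrightarrow> (h has_derivative frechet_derivative h (at x)) (at x)"
  by (simp add: frechet_derivative_works)

lemma partial_add:
  "h differentiable (at x) \<Longrightarrow> k differentiable (at x) \<Longrightarrow>
    partial i (\<lambda>y. h y + k y) x = partial i h x + partial i k x"
  by (subst partial_eqI[OF has_derivative_add[OF partial_has_derivative partial_has_derivative]])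
    (simp_all add: partial_def)

lemma partial_diff:
  "h differentiable (at x) \<Longrightarrow> k differentiable (at x) \<Longrightarrow>
    partial i (\<lambda>y. h y - k y) x = partial i h x - partial i k x"
  by (subst partial_eqI[OF has_derivative_diff[OF partial_has_derivative partial_has_derivative]])
    (simp_all add: partial_def)

lemma partial_mult:
  "h differentiable (at x) \<Longrightarrow> k differentiable (at x) \<Longrightarrow>
    partial i (\<lambda>y. h y * k y) x = h x * partial i k x + partial i h x * k x"
  by (subst partial_eqI[OF has_derivative_mult[OF partial_has_derivative partial_has_derivative]])
    (simp_all add: partial_def)

lemma partial_const: "partial i (\<lambda>_. c) x = 0"
  by (subst partial_eqI[OF has_derivative_const]) simp

lemma grad_lincomb:
  assumes "h differentiable (at x)" "k differentiable (at x)"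
  shows "grad (\<lambda>y. h y + c * k y) x = grad h x + c *\<^sub>R grad k x"
  using assms by (simp add: grad_def vec_eq_iff partial_add partial_mult partial_const)

lemma grad_mult:
  assumes "h differentiable (at x)" "k differentiable (at x)"
  shows "grad (\<lambda>y. h y * k y) x = h x *\<^sub>R grad k x + k x *\<^sub>R grad h x"
  using assms by (simp add: grad_def vec_eq_iff partial_mult)

lemma differentiable_vec_nth:
  fixes A :: "'a::real_normed_vector \<Rightarrow> real ^ 'n"
  assumes "A differentiable F"
  shows "(\<lambda>y. A y $ i) differentiable F"
  using assms bounded_linear.has_derivative[OF bounded_linear_vec_nth]
  unfolding differentiable_def by blast

lemma divergence_scaleR:
  assumes "h differentiable (at x)" "A differentiable (at x)"
  shows "divergence (\<lambda>y. h y *\<^sub>R A y) x = grad h x \<bullet> A x + h x * divergence A x"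
  using assms by (simp add: divergence_def partial_mult differentiable_vec_nth grad_def inner_vec_def
      sum.distrib sum_distrib_left algebra_simps)

lemma divergence_const: "divergence (\<lambda>_. c) x = 0"
  by (simp add: divergence_def partial_const)

lemma divergence_cross3:
  assumes "A differentiable (at x)" "B differentiable (at x)"
  shows "divergence (\<lambda>y. cross3 (A y) (B y)) x = curl A x \<bullet> B x - A x \<bullet> curl B x"
proof -
  have d: "(\<lambda>y. A y $ i) differentiable (at x)" "(\<lambda>y. B y $ i) differentiable (at x)" for i
    by (intro differentiable_vec_nth assms)+
  have m: "(\<lambda>y. A y $ i * B y $ j) differentiable (at x)" for i j
    by (intro differentiable_mult d)
  have "partial i (\<lambda>y. A y $ k * B y $ j - A y $ k' * B y $ j') x =
      A x $ k * partial i (\<lambda>y. B y $ j) x + partial i (\<lambda>y. A y $ k) x * B x $ j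
      - (A x $ k' * partial i (\<lambda>y. B y $ j') x + partial i (\<lambda>y. A y $ k') x * B x $ j')"
    for i j j' k k' by (simp add: partial_diff partial_mult m d)
  then show ?thesis
    by (simp add: divergence_def cross3_def sum_3)
      (simp add: curl_def inner_vec_def sum_3 algebra_simps)
qed

lemma curl_lincomb:
  assumes "A differentiable (at x)" "B differentiable (at x)"
  shows "curl (\<lambda>y. A y + c *\<^sub>R B y) x = curl A x + c *\<^sub>R curl B x"
proof -
  have d: "(\<lambda>y. A y $ i) differentiable (at x)" "(\<lambda>y. B y $ i) differentiable (at x)" for i
    by (intro differentiable_vec_nth assms)+
  have "partial i (\<lambda>y. A y $ k + c * B y $ k) x =
      partial i (\<lambda>y. A y $ k) x + c * partial i (\<lambda>y. B y $ k) x" for i k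
    by (simp add: partial_add partial_mult partial_const d)
  then show ?thesis
    by (simp add: curl_def vec_eq_iff forall_3 algebra_simps)
qed

lemma force_has_derivative: "(force P x has_derivative (\<lambda>d. cross3 d (B0 P))) (at v)"
proof -
  have "bounded_linear (\<lambda>d. cross3 d (B0 P))"
    using bilinear_cross by (simp add: bilinear_def linear_conv_bounded_linear)
  from has_derivative_add[OF has_derivative_const bounded_linear_imp_has_derivative[OF this]]
  show ?thesis unfolding force_def by simp
qed

lemma force_differentiable: "force P x differentiable (at v)"
  using force_has_derivative unfolding differentiable_def by blast

text \<open>\<open>E0\<close> does not depend on the velocity, and
  \<open>cross3 (axis i 1) (B0 P)\<close> is orthogonal to \<open>axis i 1\<close>, so every
  diagonal term vanishes.\<close>

lemma divergence_force: "divergence (force P x) v = 0"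
proof -
  have "partial i (\<lambda>w. force P x w $ i) v = cross3 (axis i 1) (B0 P) $ i" for i
    by (intro partial_eqI bounded_linear.has_derivative[OF bounded_linear_vec_nth] force_has_derivative)
  then show ?thesis by (simp add: divergence_def cross3_def sum_3 axis_def)
qed

lemma f0_differentiable_v:
  assumes "valid_background P"
  shows "f0 P x differentiable (at v)"
proof -
  have "vth P \<noteq> 0" using assms by (auto simp: valid_background_def)
  then have "((\<lambda>v. f0 P x v) has_derivative (\<lambda>d. - f0 P x v * (v \<bullet> d) / (vth P)\<^sup>2)) (at v)"
    unfolding f0_def power2_norm_eq_inner
    by - (rule derivative_eq_intros refl | simp add: fun_eq_iff inner_commute field_simps)+
  then show ?thesis by (auto simp: differentiable_def)
qed

lemma f0_differentiable_x:
  assumes "valid_background P" "x \<in> Omega P"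
  shows "(\<lambda>y. f0 P y v) differentiable (at x)"
proof -
  have "n0 P differentiable (at x)"
    using assms by (auto simp: valid_background_def elim: smooth_on.cases)
  then show ?thesis
    unfolding f0_def divide_inverse by (intro differentiable_mult differentiable_const)
qed


section \<open>The bracket as a pairing with a Hamiltonian vector field\<close>

text \<open>Differentiation along the characteristics of the unperturbed Vlasov equation. The
  equilibrium condition says that it annihilates \<open>f0\<close>.\<close>

definition transport :: "background \<Rightarrow> ((real^3) \<times> (real^3) \<Rightarrow> real) \<Rightarrow> real^3 \<Rightarrow> real^3 \<Rightarrow> real" where
  "transport P h x v = v \<bullet> grad_x h x v + 1 / eps P * (force P x v \<bullet> grad_v h x v)"

lemma differentiable_slices:
  fixes h :: "(real^3) \<times> (real^3) \<Rightarrow> real"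
  assumes "h differentiable (at (x, v))"
  shows "(\<lambda>y. h (y, v)) differentiable (at x)" "(\<lambda>w. h (x, w)) differentiable (at v)"
proof -
  obtain D where D: "(h has_derivative D) (at (x, v))" using assms by (auto simp: differentiable_def)
  have "((\<lambda>y. (y, v)) has_derivative (\<lambda>d. (d, 0))) (at x)" "((\<lambda>w. (x, w)) has_derivative (\<lambda>d. (0, d))) (at v)"
    by (auto intro!: derivative_eq_intros)
  from has_derivative_compose[OF this(1) D] has_derivative_compose[OF this(2) D]
  show "(\<lambda>y. h (y, v)) differentiable (at x)" "(\<lambda>w. h (x, w)) differentiable (at v)"
    unfolding differentiable_def by blast+
qed

lemma transport_lincomb:
  assumes "h differentiable (at (x, v))" "k differentiable (at (x, v))"
  shows "transport P (\<lambda>z. h z + c * k z) x v = transport P h x v + c * transport P k x v"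
  using differentiable_slices[OF assms(1)] differentiable_slices[OF assms(2)]
  by (simp add: transport_def grad_x_def grad_v_def grad_lincomb inner_add_right algebra_simps)

text \<open>In the product rule \<open>v\<close> has no divergence in \<open>x\<close>, the force
  has none in \<open>v\<close>, and the terms with derivatives of \<open>f0\<close> cancel by
  equilibrium. What remains is \<open>f0\<close> times the derivative of the product of
  \<open>h\<close> and \<open>k\<close> along characteristics.\<close>

lemma transport_divergence:
  assumes P: "valid_background P" "x \<in> Omega P"
    and h: "h differentiable (at (x, v))" and k: "k differentiable (at (x, v))"
  shows "divergence (\<lambda>y. (f0 P y v * h (y, v) * k (y, v)) *\<^sub>R v) x
      + 1 / eps P * divergence (\<lambda>w. (f0 P x w * h (x, w) * k (x, w)) *\<^sub>R force P x w) v
    = f0 P x v * (transport P h x v * k (x, v)) + f0 P x v * (transport P k x v * h (x, v))"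
proof -
  note dx = f0_differentiable_x[OF P, of v] differentiable_slices(1)[OF h] differentiable_slices(1)[OF k]
  note dv = f0_differentiable_v[OF P(1), of x v] differentiable_slices(2)[OF h] differentiable_slices(2)[OF k]
  have 1: "divergence (\<lambda>y. (f0 P y v * h (y, v) * k (y, v)) *\<^sub>R v) x
      = (f0 P x v * h (x, v)) * (v \<bullet> grad_x k x v) + k (x, v) * f0 P x v * (v \<bullet> grad_x h x v)
        + k (x, v) * h (x, v) * (v \<bullet> grad (\<lambda>y. f0 P y v) x)"
    using dx by (subst divergence_scaleR)
      (auto simp: divergence_const grad_mult grad_x_def inner_commute inner_add_right algebra_simps
        intro!: differentiable_mult)
  have 2: "divergence (\<lambda>w. (f0 P x w * h (x, w) * k (x, w)) *\<^sub>R force P x w) v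
      = (f0 P x v * h (x, v)) * (force P x v \<bullet> grad_v k x v) + k (x, v) * f0 P x v * (force P x v \<bullet> grad_v h x v)
        + k (x, v) * h (x, v) * (force P x v \<bullet> grad (f0 P x) v)"
    using dv by (subst divergence_scaleR)
      (auto simp: divergence_force grad_mult grad_v_def inner_commute inner_add_right algebra_simps
        intro!: differentiable_mult force_differentiable)
  have 3: "v \<bullet> grad (\<lambda>y. f0 P y v) x = - (1 / eps P * (force P x v \<bullet> grad (f0 P x) v))"
    using equilibrium[OF P, of v] by (simp add: grad_x_def grad_v_def)
  show ?thesis unfolding 1 2 3 transport_def by (simp add: algebra_simps)
qed

text \<open>The integrals of \<open>bracket\<close> with arbitrary fields in place of the two chosen
  functional derivatives, so that the integrations by parts are separate from the question of
  choice.\<close>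

definition bracket_form :: "background \<Rightarrow> fields \<Rightarrow> fields \<Rightarrow> real" where
  "bracket_form P a b =
       (LINT x:Omega P|lborel. curl (el a) x \<bullet> mg b x - mg a x \<bullet> curl (el b) x)
       + 1 / ((vth P)\<^sup>2 * eps P) *
         (LINT z:Omega P \<times> UNIV|lborel. (case z of (x, v) \<Rightarrow>
            (ph a (x, v) * (el b x \<bullet> v) - (el a x \<bullet> v) * ph b (x, v)) * f0 P x v))
       + 1 / 2 * (1 / ((alpha P)\<^sup>2 * (vth P)\<^sup>2)) *
         (LINT z:Omega P \<times> UNIV|lborel. (case z of (x, v) \<Rightarrow>
            f0 P x v *
            (v \<bullet> (ph b (x, v) *\<^sub>R grad_x (ph a) x v - ph a (x, v) *\<^sub>R grad_x (ph b) x v)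
             + 1 / eps P * (force P x v \<bullet>
                 (ph b (x, v) *\<^sub>R grad_v (ph a) x v - ph a (x, v) *\<^sub>R grad_v (ph b) x v)))))"

lemma bracket_eq_bracket_form:
  "bracket P TX TY F G u = bracket_form P
     (functional_derivative P (topspace TX) (topspace TY) F u)
     (functional_derivative P (topspace TX) (topspace TY) G u)"
  by (simp add: bracket_def bracket_form_def Let_def)

lemma set_integral_minus: "(LINT z:A|M. - f z) = - (LINT z:A|M. f z)"
  for f :: "_ \<Rightarrow> _::{banach, second_countable_topology}"
  by (simp add: set_lebesgue_integral_def)

lemma bracket_form_antisymmetric: "bracket_form P a b = - bracket_form P b a"
  unfolding bracket_form_def minus_add_distrib mult_minus_right[symmetric] set_integral_minus[symmetric]
  by (intro arg_cong2[where f = "(+)"] arg_cong2[where f = "(*)"] refl arg_cong[where f = "set_lebesgue_integral _ _"] ext)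
    (auto simp: inner_diff_right inner_commute algebra_simps)

text \<open>The velocity moment that enters the electric component of \<open>ham_op\<close>, where
  it plays the part of the current in Ampere's law.\<close>

definition current :: "background \<Rightarrow> fields \<Rightarrow> real^3 \<Rightarrow> real^3" where
  "current P b x = (LINT v|lborel. (f0 P x v * ph b (x, v)) *\<^sub>R v)"

section \<open>Integration by parts\<close>

locale bracket_setting = admissible_spaces +
  assumes valid: "valid_background P"
begin

abbreviation "X \<equiv> topspace TX"
abbreviation "Y \<equiv> topspace TY"

lemma sets_Omega: "Omega P \<in> sets borel" "Omega P \<times> (UNIV :: (real^3) set) \<in> sets borel"
  using valid by (auto simp: valid_background_def intro!: borel_open open_Times)

lemma differentiable_Y:
  assumes "y \<in> Y" "x \<in> Omega P"
  shows "ph y differentiable (at (x, v))" "el y differentiable (at x)" "mg y differentiable (at x)"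
  using regular_Y[OF assms(1)] assms(2) by (auto simp: differentiable_fields_def)

lemma ham_op_mem: "y \<in> Y \<Longrightarrow> ham_op P y \<in> X"
  using ham_op_continuous by (auto simp: continuous_map_def)

lemma transport_integrable:
  assumes "a \<in> Y" "b \<in> Y"
  shows "set_integrable lborel (Omega P \<times> UNIV) (\<lambda>(x, v). f0 P x v * (transport P (ph a) x v * ph b (x, v)))"
proof -
  from bracket_integrable[OF assms]
  have "set_integrable lborel (Omega P \<times> UNIV) (\<lambda>z.
      (case z of (x, v) \<Rightarrow> f0 P x v * ((v \<bullet> grad_x (ph a) x v) * ph b (x, v)))
      + 1 / eps P * (case z of (x, v) \<Rightarrow> f0 P x v * ((force P x v \<bullet> grad_v (ph a) x v) * ph b (x, v))))"
    by (intro set_integral_add set_integrable_mult_right) auto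
  then show ?thesis
    by (rule set_integrable_cong[THEN iffD1, rotated -1]) (auto simp: transport_def algebra_simps)
qed

text \<open>The identity \<open>transport_divergence\<close> is integrated: its left side gives zero
  by the boundary assumptions, and its right side is the sum of the two integrals compared
  here.\<close>

lemma transport_antisymmetric:
  assumes a: "a \<in> Y" and b: "b \<in> Y"
  shows "(LINT (x, v):Omega P \<times> UNIV|lborel. f0 P x v * (transport P (ph a) x v * ph b (x, v)))
    = - (LINT (x, v):Omega P \<times> UNIV|lborel. f0 P x v * (transport P (ph b) x v * ph a (x, v)))"
proof -
  have "0 = (LINT z:Omega P \<times> UNIV|lborel.
      (case z of (x, v) \<Rightarrow> divergence (\<lambda>x. (f0 P x v * ph a (x, v) * ph b (x, v)) *\<^sub>R v) x)
      + 1 / eps P * (case z of (x, v) \<Rightarrow>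
          divergence (\<lambda>v. (f0 P x v * ph a (x, v) * ph b (x, v)) *\<^sub>R force P x v) v))"
    using no_boundary_x[OF a b] no_boundary_v[OF a b]
    by (subst set_integral_add(2)) auto
  also have "\<dots> = (LINT z:Omega P \<times> UNIV|lborel.
      (case z of (x, v) \<Rightarrow> f0 P x v * (transport P (ph a) x v * ph b (x, v)))
      + (case z of (x, v) \<Rightarrow> f0 P x v * (transport P (ph b) x v * ph a (x, v))))"
    by (rule set_lebesgue_integral_cong)
      (use transport_divergence[OF valid] differentiable_Y a b sets_Omega in auto)
  also have "\<dots> = (LINT (x, v):Omega P \<times> UNIV|lborel. f0 P x v * (transport P (ph a) x v * ph b (x, v)))
      + (LINT (x, v):Omega P \<times> UNIV|lborel. f0 P x v * (transport P (ph b) x v * ph a (x, v)))"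
    by (rule set_integral_add(2)[OF transport_integrable[OF a b] transport_integrable[OF b a]])
  finally show ?thesis by simp
qed

text \<open>Fubini's theorem turns the spatial pairing with the current into a phase-space integral,
  which can then be compared with the coupling term of the bracket.\<close>

lemma
  assumes a: "a \<in> Y" and b: "b \<in> Y"
  shows current_pairing_integrable: "set_integrable lborel (Omega P) (\<lambda>x. el a x \<bullet> current P b x)"
    and current_pairing: "(LINT x:Omega P|lborel. el a x \<bullet> current P b x) =
      (LINT (x, v):Omega P \<times> UNIV|lborel. f0 P x v * (ph b (x, v) * (el a x \<bullet> v)))"
proof -
  let ?f = "\<lambda>z. indicator (Omega P \<times> UNIV) z *\<^sub>R (case z of (x, v) \<Rightarrow> f0 P x v * (ph b (x, v) * (el a x \<bullet> v)))"
  have int: "integrable (lborel \<Otimes>\<^sub>M lborel) ?f"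
    using bracket_integrable[OF b a] unfolding lborel_prod by (auto simp: set_integrable_def)
  \<comment> \<open>For \<open>x\<close> in the domain, \<open>el a x\<close> is constant in the
    velocity and is pulled out of the integral; elsewhere the indicator makes both sides
    zero.\<close>
  have eq: "(LINT v|lborel. ?f (x, v)) = indicator (Omega P) x *\<^sub>R (el a x \<bullet> current P b x)" for x
  proof (cases "x \<in> Omega P")
    case True
    have "el a x \<bullet> current P b x = (LINT v|lborel. el a x \<bullet> ((f0 P x v * ph b (x, v)) *\<^sub>R v))"
      unfolding current_def
      by (rule integral_inner_right[symmetric]) (use current_integrable[OF b True] in auto)
    then show ?thesis using True by (simp add: algebra_simps)
  qed simp
  show "set_integrable lborel (Omega P) (\<lambda>x. el a x \<bullet> current P b x)"
    using lborel_pair.integrable_fst'[OF int] unfolding eq set_integrable_def .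
  show "(LINT x:Omega P|lborel. el a x \<bullet> current P b x) =
      (LINT (x, v):Omega P \<times> UNIV|lborel. f0 P x v * (ph b (x, v) * (el a x \<bullet> v)))"
    using lborel_pair.integral_fst'[OF int] unfolding eq set_lebesgue_integral_def lborel_prod .
qed

lemma curl_integral:
  assumes a: "a \<in> Y" and b: "b \<in> Y"
  shows "(LINT x:Omega P|lborel. curl (el a) x \<bullet> mg b x) = (LINT x:Omega P|lborel. el a x \<bullet> curl (mg b) x)"
proof -
  have "0 = (LINT x:Omega P|lborel. divergence (\<lambda>x. cross3 (el a x) (mg b x)) x)"
    using no_boundary_EB[OF a b] by simp
  also have "\<dots> = (LINT x:Omega P|lborel. curl (el a) x \<bullet> mg b x - el a x \<bullet> curl (mg b) x)"
    by (rule set_lebesgue_integral_cong)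
      (use divergence_cross3 differentiable_Y a b sets_Omega in auto)
  also have "\<dots> = (LINT x:Omega P|lborel. curl (el a) x \<bullet> mg b x) - (LINT x:Omega P|lborel. el a x \<bullet> curl (mg b) x)"
    using bracket_integrable[OF a b] by (intro set_integral_diff(2)) auto
  finally show ?thesis by simp
qed

text \<open>All derivatives are moved from \<open>a\<close> to \<open>b\<close>. The coupling
  integral splits into a part tested against \<open>ph a\<close>, which goes to the phase-space
  component of \<open>ham_op\<close>, and a part tested against \<open>el a\<close>, which becomes
  its current term.\<close>

lemma bracket_form_eq_pairing:
  assumes a: "a \<in> Y" and b: "b \<in> Y"
  shows "bracket_form P a b = pairing P a (ham_op P b)"
proof -
  let ?W = "Omega P \<times> UNIV :: ((real^3) \<times> (real^3)) set"
  let ?k = "1 / ((vth P)\<^sup>2 * eps P)" and ?m = "1 / ((alpha P)\<^sup>2 * (vth P)\<^sup>2)"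
  let ?I = "\<lambda>a b. LINT (x, v):?W|lborel. f0 P x v * (ph a (x, v) * (el b x \<bullet> v))"
  let ?K = "\<lambda>a b. LINT (x, v):?W|lborel. f0 P x v * (transport P (ph a) x v * ph b (x, v))"
  note ab = bracket_integrable[OF a b] and ba = bracket_integrable[OF b a]
  have EB: "(LINT x:Omega P|lborel. curl (el a) x \<bullet> mg b x - mg a x \<bullet> curl (el b) x) =
      (LINT x:Omega P|lborel. el a x \<bullet> curl (mg b) x) - (LINT x:Omega P|lborel. mg a x \<bullet> curl (el b) x)"
    unfolding curl_integral[OF a b, symmetric]
    using ab ba by (intro set_integral_diff(2)) (auto simp: inner_commute)
  have source_part: "(LINT z:?W|lborel. (case z of (x, v) \<Rightarrow>
      (ph a (x, v) * (el b x \<bullet> v) - (el a x \<bullet> v) * ph b (x, v)) * f0 P x v)) = ?I a b - ?I b a"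
  proof -
    have "?I a b - ?I b a = (LINT z:?W|lborel.
       (case z of (x, v) \<Rightarrow> f0 P x v * (ph a (x, v) * (el b x \<bullet> v)))
      - (case z of (x, v) \<Rightarrow> f0 P x v * (ph b (x, v) * (el a x \<bullet> v))))"
      by (rule set_integral_diff(2)[symmetric]) (use ab ba in auto)
    also have "\<dots> = (LINT z:?W|lborel. (case z of (x, v) \<Rightarrow>
      (ph a (x, v) * (el b x \<bullet> v) - (el a x \<bullet> v) * ph b (x, v)) * f0 P x v))"
      by (rule set_lebesgue_integral_cong) (auto simp: sets_Omega algebra_simps)
    finally show ?thesis ..
  qed
  \<comment> \<open>By antisymmetry of the transport integral the two halves are equal; the
    resulting 2 cancels the factor 1/2 in the bracket.\<close>
  have transport_part: "(LINT z:?W|lborel. (case z of (x, v) \<Rightarrow>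
            f0 P x v *
            (v \<bullet> (ph b (x, v) *\<^sub>R grad_x (ph a) x v - ph a (x, v) *\<^sub>R grad_x (ph b) x v)
             + 1 / eps P * (force P x v \<bullet>
                 (ph b (x, v) *\<^sub>R grad_v (ph a) x v - ph a (x, v) *\<^sub>R grad_v (ph b) x v)))))
      = - 2 * ?K b a"
  proof -
    have "- 2 * ?K b a = ?K a b - ?K b a"
      using transport_antisymmetric[OF a b] by simp
    also have "\<dots> = (LINT z:?W|lborel.
       (case z of (x, v) \<Rightarrow> f0 P x v * (transport P (ph a) x v * ph b (x, v)))
      - (case z of (x, v) \<Rightarrow> f0 P x v * (transport P (ph b) x v * ph a (x, v))))"
      by (rule set_integral_diff(2)[OF transport_integrable[OF a b] transport_integrable[OF b a], symmetric])
    also have "\<dots> = (LINT z:?W|lborel. (case z of (x, v) \<Rightarrow>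
            f0 P x v *
            (v \<bullet> (ph b (x, v) *\<^sub>R grad_x (ph a) x v - ph a (x, v) *\<^sub>R grad_x (ph b) x v)
             + 1 / eps P * (force P x v \<bullet>
                 (ph b (x, v) *\<^sub>R grad_v (ph a) x v - ph a (x, v) *\<^sub>R grad_v (ph b) x v)))))"
      by (rule set_lebesgue_integral_cong)
        (auto simp: sets_Omega transport_def inner_diff_right algebra_simps)
    finally show ?thesis ..
  qed
  have f_part: "(LINT z:?W|lborel. ph a z * ph (ham_op P b) z) = ?k * ?I a b - ?m * ?K b a"
  proof -
    have "?k * ?I a b - ?m * ?K b a = (LINT z:?W|lborel.
       ?k * (case z of (x, v) \<Rightarrow> f0 P x v * (ph a (x, v) * (el b x \<bullet> v)))
      - ?m * (case z of (x, v) \<Rightarrow> f0 P x v * (transport P (ph b) x v * ph a (x, v))))"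
      unfolding set_integral_mult_right[symmetric]
      by (intro set_integral_diff(2)[symmetric] set_integrable_mult_right transport_integrable b a)
        (use ab in auto)
    also have "\<dots> = (LINT z:?W|lborel. ph a z * ph (ham_op P b) z)"
      by (rule set_lebesgue_integral_cong)
        (auto simp: sets_Omega ham_op_def transport_def add_divide_distrib algebra_simps)
    finally show ?thesis ..
  qed
  have E_part: "(LINT x:Omega P|lborel. el a x \<bullet> el (ham_op P b) x) =
      (LINT x:Omega P|lborel. el a x \<bullet> curl (mg b) x) - ?k * ?I b a"
  proof -
    have "(LINT x:Omega P|lborel. el a x \<bullet> el (ham_op P b) x) =
        (LINT x:Omega P|lborel. el a x \<bullet> curl (mg b) x - ?k * (el a x \<bullet> current P b x))"
      by (rule set_lebesgue_integral_cong)
        (auto simp: sets_Omega ham_op_def current_def inner_diff_right)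
    also have "\<dots> = (LINT x:Omega P|lborel. el a x \<bullet> curl (mg b) x)
        - (LINT x:Omega P|lborel. ?k * (el a x \<bullet> current P b x))"
      using ab current_pairing_integrable[OF a b] by (intro set_integral_diff(2) set_integrable_mult_right) auto
    finally show ?thesis by (simp add: current_pairing[OF a b])
  qed
  have B_part: "(LINT x:Omega P|lborel. mg a x \<bullet> mg (ham_op P b) x) =
      - (LINT x:Omega P|lborel. mg a x \<bullet> curl (el b) x)"
    unfolding set_integral_minus[symmetric]
    by (rule set_lebesgue_integral_cong) (auto simp: sets_Omega ham_op_def)
  show ?thesis
    unfolding bracket_form_def pairing_def EB source_part transport_part f_part E_part B_part by (simp add: right_diff_distrib)
qed

text \<open>Admissibility supplies the differentiability for the curl and transport terms and the
  convergence of the velocity integral. Off the domain all components are zero by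
  definition.\<close>

lemma ham_op_linear:
  assumes a: "a \<in> Y" and b: "b \<in> Y"
  shows "ham_op P (a + c *\<^sub>R b) = ham_op P a + c *\<^sub>R ham_op P b"
proof -
  have comp: "ph (a + c *\<^sub>R b) = (\<lambda>z. ph a z + c * ph b z)"
    "el (a + c *\<^sub>R b) = (\<lambda>x. el a x + c *\<^sub>R el b x)" "mg (a + c *\<^sub>R b) = (\<lambda>x. mg a x + c *\<^sub>R mg b x)"
    by (auto simp: plus_fields_def scaleR_fields_def)
  have "current P (a + c *\<^sub>R b) x = current P a x + c *\<^sub>R current P b x" if "x \<in> Omega P" for x
  proof -
    have "current P (a + c *\<^sub>R b) x =
        (LINT v|lborel. (f0 P x v * ph a (x, v)) *\<^sub>R v + c *\<^sub>R ((f0 P x v * ph b (x, v)) *\<^sub>R v))"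
      unfolding current_def comp by (simp add: algebra_simps)
    also have "\<dots> = current P a x + c *\<^sub>R current P b x"
      unfolding current_def using current_integrable[OF a that] current_integrable[OF b that]
      by (subst Bochner_Integration.integral_add) (auto simp del: scaleR_scaleR)
    finally show ?thesis .
  qed
  moreover have "transport P (ph (a + c *\<^sub>R b)) x v = transport P (ph a) x v + c * transport P (ph b) x v"
    if "x \<in> Omega P" for x v
    unfolding comp using a b that by (intro transport_lincomb differentiable_Y)
  moreover have "curl (el (a + c *\<^sub>R b)) x = curl (el a) x + c *\<^sub>R curl (el b) x"
    "curl (mg (a + c *\<^sub>R b)) x = curl (mg a) x + c *\<^sub>R curl (mg b) x" if "x \<in> Omega P" for x
    unfolding comp using a b that by (auto intro!: curl_lincomb differentiable_Y)
  \<comment> \<open>The field operations are unfolded only on explicit triples, so that the argument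
    \<open>a + c *\<^sub>R b\<close> stays intact for the facts just collected.\<close>
  ultimately show ?thesis
    unfolding ham_op_def plus_fields_def[of "Fields _ _ _"] scaleR_fields_def[of c "Fields _ _ _"]
      current_def[symmetric] transport_def[symmetric]
    by (auto simp: fun_eq_iff comp(2) inner_add_left add_divide_distrib diff_divide_distrib algebra_simps)
qed

lemma pairing_linear_left:
  assumes y: "y \<in> Y" and y': "y' \<in> Y" and w: "w \<in> X"
  shows "pairing P (y + c *\<^sub>R y') w = pairing P y w + c * pairing P y' w"
proof -
  have "pairing P (y + c *\<^sub>R y') w =
     (LINT z:Omega P \<times> UNIV|lborel. ph y z * ph w z + c * (ph y' z * ph w z)) +
     (LINT x:Omega P|lborel. el y x \<bullet> el w x + c * (el y' x \<bullet> el w x)) +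
     (LINT x:Omega P|lborel. mg y x \<bullet> mg w x + c * (mg y' x \<bullet> mg w x))"
    unfolding pairing_def by (simp add: plus_fields_def scaleR_fields_def inner_add_left algebra_simps)
  also have "\<dots> = pairing P y w + c * pairing P y' w"
    using pairing_integrable[OF y w] pairing_integrable[OF y' w]
    unfolding pairing_def by (subst (1 2 3) set_integral_add(2)) (auto simp: algebra_simps)
  finally show ?thesis .
qed

lemma pairing_linear_right:
  assumes y: "y \<in> Y" and w: "w \<in> X" and w': "w' \<in> X"
  shows "pairing P y (w + c *\<^sub>R w') = pairing P y w + c * pairing P y w'"
proof -
  have "pairing P y (w + c *\<^sub>R w') =
     (LINT z:Omega P \<times> UNIV|lborel. ph y z * ph w z + c * (ph y z * ph w' z)) +
     (LINT x:Omega P|lborel. el y x \<bullet> el w x + c * (el y x \<bullet> el w' x)) +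
     (LINT x:Omega P|lborel. mg y x \<bullet> mg w x + c * (mg y x \<bullet> mg w' x))"
    unfolding pairing_def by (simp add: plus_fields_def scaleR_fields_def inner_add_right algebra_simps)
  also have "\<dots> = pairing P y w + c * pairing P y w'"
    using pairing_integrable[OF y w] pairing_integrable[OF y w']
    unfolding pairing_def by (subst (1 2 3) set_integral_add(2)) (auto simp: algebra_simps)
  finally show ?thesis .
qed

end

section \<open>Gradients of functionals and the Poisson identities\<close>

context bracket_setting
begin

abbreviation gradient_at :: "(fields \<Rightarrow> real) \<Rightarrow> fields \<Rightarrow> fields \<Rightarrow> bool" where
  "gradient_at F u y \<equiv> has_functional_derivative P X F u y \<and> y \<in> Y"

lemma zero_Y: "0 \<in> Y"
  by (rule tvs_zero_mem[OF tvs_Y])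

lemma line_X: "u \<in> X \<Longrightarrow> w \<in> X \<Longrightarrow> u + t *\<^sub>R w \<in> X"
  by (intro tvs_add_mem[OF tvs_X] tvs_scaleR_mem[OF tvs_X])

lemma lincomb_Y: "y \<in> Y \<Longrightarrow> y' \<in> Y \<Longrightarrow> c *\<^sub>R y + d *\<^sub>R y' \<in> Y"
  by (intro tvs_add_mem[OF tvs_Y] tvs_scaleR_mem[OF tvs_Y])

lemma pairing_lincomb:
  assumes "y \<in> Y" "y' \<in> Y" "w \<in> X"
  shows "pairing P (c *\<^sub>R y + d *\<^sub>R y') w = c * pairing P y w + d * pairing P y' w"
proof -
  have "pairing P 0 w = 0"
    using pairing_linear_left[OF zero_Y zero_Y assms(3), of 1] by simp
  then show ?thesis
    using pairing_linear_left[OF tvs_scaleR_mem[OF tvs_Y assms(1)] assms(2,3), of c d]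
      pairing_linear_left[OF zero_Y assms(1,3), of c] by simp
qed

text \<open>Two functional derivatives may differ, for instance on a null set; the variations see
  only their pairings, which are real derivatives of \<open>F\<close> along lines.\<close>

lemma functional_derivative_unique:
  assumes "has_functional_derivative P X F u y" "has_functional_derivative P X F u y'" "w \<in> X"
  shows "pairing P y w = pairing P y' w"
  using assms DERIV_unique unfolding has_functional_derivative_def by blast

text \<open>Frees the bracket from the choice operator: any admissible gradients may be used,
  because the values of \<open>ham_op P\<close> are admissible variations and uniqueness of pairings
  applies to them.\<close>

lemma bracket_eq_pairing:
  assumes y: "gradient_at F u y" and z: "gradient_at G u z"
  shows "bracket P TX TY F G u = pairing P y (ham_op P z)"
proof -
  let ?y = "functional_derivative P X Y F u" and ?z = "functional_derivative P X Y G u"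
  have y': "gradient_at F u ?y"
    unfolding functional_derivative_def by (rule someI2[of _ y]) (use y in auto)
  have z': "gradient_at G u ?z"
    unfolding functional_derivative_def by (rule someI2[of _ z]) (use z in auto)
  have "bracket_form P ?y ?z = bracket_form P y ?z"
    using y y' z' functional_derivative_unique[of F u ?y y] ham_op_mem by (simp add: bracket_form_eq_pairing)
  \<comment> \<open>Antisymmetry brings the second gradient into the left slot, where uniqueness of
    pairings can be used.\<close>
  also have "\<dots> = bracket_form P y z"
    unfolding bracket_form_antisymmetric[of P y]
    using y z z' functional_derivative_unique[of G u ?z z] ham_op_mem by (simp add: bracket_form_eq_pairing)
  finally show ?thesis using y z by (simp add: bracket_eq_bracket_form bracket_form_eq_pairing)
qed

lemma pairing_ham_op_antisymmetric:
  "a \<in> Y \<Longrightarrow> b \<in> Y \<Longrightarrow> pairing P a (ham_op P b) = - pairing P b (ham_op P a)"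
  using bracket_form_antisymmetric[of P a b] by (simp add: bracket_form_eq_pairing)

lemma gradient_at_lincomb:
  assumes "gradient_at F u y" "gradient_at G u z"
  shows "gradient_at (\<lambda>u. c * F u + d * G u) u (c *\<^sub>R y + d *\<^sub>R z)"
  using assms unfolding has_functional_derivative_def
  by (auto intro!: derivative_eq_intros lincomb_Y simp: pairing_lincomb)

lemma gradient_at_mult:
  assumes "gradient_at F u y" "gradient_at G u z"
  shows "gradient_at (\<lambda>u. F u * G u) u (G u *\<^sub>R y + F u *\<^sub>R z)"
proof -
  have "((\<lambda>s. F (u + s *\<^sub>R w) * G (u + s *\<^sub>R w)) has_real_derivative
      pairing P y w * G (u + 0 *\<^sub>R w) + pairing P z w * F (u + 0 *\<^sub>R w)) (at 0)" if "w \<in> X" for w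
    using assms that unfolding has_functional_derivative_def by (intro DERIV_mult) auto
  then show ?thesis
    using assms unfolding has_functional_derivative_def
    by (auto intro!: lincomb_Y simp: pairing_lincomb mult.commute)
qed

text \<open>\<open>D u []\<close> is a gradient and \<open>D u [w]\<close> plays the part of the
  Hessian applied to \<open>w\<close>. Neither gradients nor limits in \<open>TY\<close> need be
  unique, so a tower is fixed once per functional and compared only through pairings.\<close>

abbreviation smooth_gradient :: "(fields \<Rightarrow> real) \<Rightarrow> (fields \<Rightarrow> fields list \<Rightarrow> fields) \<Rightarrow> bool" where
  "smooth_gradient F D \<equiv> smooth_derivs TX TY D \<and> (\<forall>u\<in>X. gradient_at F u (D u []))"

lemma functionals_smooth_gradient:
  assumes "F \<in> functionals P TX TY"
  obtains D where "smooth_gradient F D"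
proof -
  obtain g where "smooth_map TX TY g" and g: "\<forall>u\<in>X. has_functional_derivative P X F u (g u)"
    using assms by (auto simp: functionals_def)
  then obtain D where D: "smooth_derivs TX TY D" "\<forall>u\<in>X. D u [] = g u"
    by (auto simp: smooth_map_iff)
  then have "D u [] \<in> Y" if "u \<in> X" for u
    using that by (intro smooth_derivs_mem[OF D(1)]) auto
  with g D have "smooth_gradient F D" by auto
  then show ?thesis by (rule that)
qed

lemma smooth_gradient_mem:
  "\<lbrakk>smooth_gradient F D; u \<in> X; set ws \<subseteq> X\<rbrakk> \<Longrightarrow> D u ws \<in> Y"
  using smooth_derivs_mem[of TX TY D u ws] by (auto simp: lists_eq_set)

lemma functionalsI:
  assumes "smooth_map TX euclideanreal F" "smooth_map TX TY g" "\<And>u. u \<in> X \<Longrightarrow> gradient_at F u (g u)"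
  shows "F \<in> functionals P TX TY"
  using assms by (auto simp: functionals_def)

lemma functionals_smooth_map: "F \<in> functionals P TX TY \<Longrightarrow> smooth_map TX euclideanreal F"
  by (simp add: functionals_def)

lemma smooth_gradient_smooth_map: "smooth_gradient F D \<Longrightarrow> smooth_map TX TY (\<lambda>u. D u [])"
  by (auto simp: smooth_map_iff)

lemma functionals_lincomb:
  assumes F: "F \<in> functionals P TX TY" and G: "G \<in> functionals P TX TY"
  shows "(\<lambda>u. c * F u + d * G u) \<in> functionals P TX TY"
proof -
  obtain D where D: "smooth_gradient F D" using functionals_smooth_gradient[OF F] .
  obtain D' where D': "smooth_gradient G D'" using functionals_smooth_gradient[OF G] .
  show ?thesis
  proof (rule functionalsI)
    show "smooth_map TX euclideanreal (\<lambda>u. c * F u + d * G u)"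
      using smooth_map_lincomb[OF topological_vector_space_euclideanreal
          functionals_smooth_map[OF F] functionals_smooth_map[OF G]] by simp
    show "smooth_map TX TY (\<lambda>u. c *\<^sub>R D u [] + d *\<^sub>R D' u [])"
      by (intro smooth_map_lincomb tvs_Y smooth_gradient_smooth_map[OF D] smooth_gradient_smooth_map[OF D'])
    show "gradient_at (\<lambda>u. c * F u + d * G u) u (c *\<^sub>R D u [] + d *\<^sub>R D' u [])" if "u \<in> X" for u
      by (rule gradient_at_lincomb) (use D D' that in auto)
  qed
qed

lemma functionals_mult:
  assumes F: "F \<in> functionals P TX TY" and G: "G \<in> functionals P TX TY"
  shows "(\<lambda>u. F u * G u) \<in> functionals P TX TY"
proof -
  obtain D where D: "smooth_gradient F D" using functionals_smooth_gradient[OF F] .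
  obtain D' where D': "smooth_gradient G D'" using functionals_smooth_gradient[OF G] .
  show ?thesis
  proof (rule functionalsI)
    show "smooth_map TX euclideanreal (\<lambda>u. F u * G u)"
      using smooth_map_scaleR[OF tvs_X topological_vector_space_euclideanreal
          functionals_smooth_map[OF F] functionals_smooth_map[OF G]] by simp
    show "smooth_map TX TY (\<lambda>u. G u *\<^sub>R D u [] + F u *\<^sub>R D' u [])"
      using smooth_map_lincomb[OF tvs_Y
          smooth_map_scaleR[OF tvs_X tvs_Y functionals_smooth_map[OF G] smooth_gradient_smooth_map[OF D]]
          smooth_map_scaleR[OF tvs_X tvs_Y functionals_smooth_map[OF F] smooth_gradient_smooth_map[OF D']],
          of 1 1] by simp
    show "gradient_at (\<lambda>u. F u * G u) u (G u *\<^sub>R D u [] + F u *\<^sub>R D' u [])" if "u \<in> X" for u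
      by (rule gradient_at_mult) (use D D' that in auto)
  qed
qed

text \<open>\<open>F\<close> has a tower of real derivatives, and its gradient has a tower in
  \<open>TY\<close>. Uniqueness of real derivatives identifies the first with the pairings of the
  second up to order two, where Schwarz's theorem applies.\<close>

lemma second_derivative_symmetric:
  assumes F: "F \<in> functionals P TX TY" and D: "smooth_gradient F D"
    and u: "u \<in> X" and v: "v \<in> X" and w: "w \<in> X"
  shows "pairing P (D u [v]) w = pairing P (D u [w]) v"
proof -
  obtain DF where DF: "smooth_derivs TX euclideanreal DF" "\<And>u. u \<in> X \<Longrightarrow> DF u [] = F u"
    using functionals_smooth_map[OF F] by (auto simp: smooth_map_iff)
  note DF_deriv = smooth_derivs_has_derivative[OF tvs_X DF(1), where t = 0, simplified]
  have first: "DF u [w] = pairing P (D u []) w" if u: "u \<in> X" and w: "w \<in> X" for u w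
  proof (rule DERIV_unique)
    show "((\<lambda>s. F (u + s *\<^sub>R w)) has_real_derivative DF u [w]) (at 0)"
      using DF_deriv[OF u w, of "[]"] by (simp add: DF(2) line_X[OF u w])
    show "((\<lambda>s. F (u + s *\<^sub>R w)) has_real_derivative pairing P (D u []) w) (at 0)"
      using D u w by (auto simp: has_functional_derivative_def)
  qed
  have second: "DF u [v, w] = pairing P (D u [v]) w" if v: "v \<in> X" and w: "w \<in> X" for v w
  proof (rule DERIV_unique)
    show "((\<lambda>s. DF (u + s *\<^sub>R v) [w]) has_real_derivative DF u [v, w]) (at 0)"
      using DF_deriv[OF u v, of "[w]"] w by simp
    \<comment> \<open>Continuity of the pairing in its left slot allows differentiation of the
      gradient under the pairing.\<close>
    have "continuous_map TY euclideanreal (\<lambda>y. pairing P y w)"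
      by (rule continuous_map_compose2[OF pairing_continuous]) (use w in auto)
    from smooth_derivs_continuous_linear[OF tvs_X tvs_Y this]
    have "smooth_derivs TX euclideanreal (\<lambda>u ws. pairing P (D u ws) w)"
      using D w by (simp add: pairing_linear_left)
    from smooth_derivs_has_derivative[OF tvs_X this u v, of "[]" 0]
    show "((\<lambda>s. DF (u + s *\<^sub>R v) [w]) has_real_derivative pairing P (D u [v]) w) (at 0)"
      by (simp add: first line_X[OF u v] w)
  qed
  show ?thesis
    using smooth_derivs_symmetric[OF tvs_X DF(1) u v w] by (simp add: second v w)
qed

text \<open>The product rule in direction \<open>w\<close> gives one term for each gradient and none
  for \<open>ham_op P\<close>, which is independent of the state. Antisymmetry puts the
  differentiated gradient on the left in both terms; symmetry of the second derivatives then
  isolates \<open>w\<close>.\<close>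

lemma bracket_gradient:
  assumes F: "F \<in> functionals P TX TY" and D: "smooth_gradient F D"
    and G: "G \<in> functionals P TX TY" and D': "smooth_gradient G D'"
  defines "g \<equiv> \<lambda>u. D u [ham_op P (D' u [])] - D' u [ham_op P (D u [])]"
  shows "smooth_map TX euclideanreal (bracket P TX TY F G)"
    and "smooth_map TX TY g"
    and "u \<in> X \<Longrightarrow> gradient_at (bracket P TX TY F G) u (g u)"
proof -
  have ham: "smooth_derivs TX TX (\<lambda>u ws. ham_op P (E u ws))" if "smooth_derivs TX TY E" for E
    using smooth_derivs_continuous_linear[OF tvs_X tvs_Y ham_op_continuous _ that] by (simp add: ham_op_linear)
  have br: "bracket P TX TY F G u = pairing P (D u []) (ham_op P (D' u []))" if "u \<in> X" for u
    using D D' that by (intro bracket_eq_pairing) auto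
  have H: "smooth_derivs TX euclideanreal
      (\<lambda>u ws. \<Sum>(p, q)\<leftarrow>list_splits ws. pairing P (D u p) (ham_op P (D' u q)))"
    by (rule smooth_derivs_bilinear[OF tvs_X tvs_Y tvs_X topological_vector_space_euclideanreal
          pairing_continuous])
      (use D D' in \<open>auto simp: pairing_linear_left pairing_linear_right intro!: ham\<close>)
  then show "smooth_map TX euclideanreal (bracket P TX TY F G)"
    by (rule smooth_mapI) (simp add: br)
  have insert: "smooth_derivs TX TY (\<lambda>u ws. \<Sum>(p, q)\<leftarrow>list_splits ws. E u (p @ [ham_op P (E' u q)]))"
    if "smooth_derivs TX TY E" "smooth_derivs TX TY E'" for E E'
    by (rule smooth_derivs_insert[OF tvs_X tvs_Y that(1) ham[OF that(2)]])
  \<comment> \<open>At the empty list each Leibniz sum has a single term, so the combination with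
    coefficients 1 and -1 starts with \<open>g\<close>.\<close>
  show g: "smooth_map TX TY g"
    by (rule smooth_mapI[OF smooth_derivs_lincomb[OF tvs_Y insert[of D D'] insert[of D' D], of 1 "-1"]])
      (use D D' in \<open>auto simp: g_def\<close>)
  assume u: "u \<in> X"
  have mem: "D u ws \<in> Y" "D' u ws \<in> Y" if "set ws \<subseteq> X" for ws
    using smooth_gradient_mem[OF D u that] smooth_gradient_mem[OF D' u that] by simp_all
  have "((\<lambda>s. bracket P TX TY F G (u + s *\<^sub>R w)) has_real_derivative pairing P (g u) w) (at 0)"
    if w: "w \<in> X" for w
  proof -
    note sym = second_derivative_symmetric[OF _ _ u w]
    have "pairing P (g u) w = pairing P (D u [ham_op P (D' u [])]) w - pairing P (D' u [ham_op P (D u [])]) w"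
      using pairing_lincomb[of "D u [ham_op P (D' u [])]" "D' u [ham_op P (D u [])]" w 1 "-1"] mem w
      by (simp add: g_def ham_op_mem)
    also have "\<dots> = pairing P (D u [w]) (ham_op P (D' u [])) - pairing P (D' u [w]) (ham_op P (D u []))"
      using sym[OF F D] sym[OF G D'] mem by (simp add: ham_op_mem)
    also have "\<dots> = pairing P (D u [w]) (ham_op P (D' u [])) + pairing P (D u []) (ham_op P (D' u [w]))"
      using mem w by (simp add: pairing_ham_op_antisymmetric[of "D u []" "D' u [w]"])
    \<comment> \<open>For the single direction \<open>w\<close> the tower \<open>H\<close> has two
      terms, with \<open>w\<close> falling on either gradient; these are the two terms just
      reached.\<close>
    finally show ?thesis
      using smooth_derivs_has_derivative[OF tvs_X H u w, of "[]" 0]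
      by (simp add: br line_X[OF u w] add.commute)
  qed
  moreover have "g u \<in> Y"
    unfolding g_def using mem by (intro tvs_diff_mem[OF tvs_Y]) (auto simp: ham_op_mem)
  ultimately show "gradient_at (bracket P TX TY F G) u (g u)"
    by (simp add: has_functional_derivative_def)
qed

lemma functionals_bracket:
  assumes "F \<in> functionals P TX TY" "G \<in> functionals P TX TY"
  shows "bracket P TX TY F G \<in> functionals P TX TY"
proof -
  obtain D where D: "smooth_gradient F D" using functionals_smooth_gradient[OF assms(1)] .
  obtain D' where D': "smooth_gradient G D'" using functionals_smooth_gradient[OF assms(2)] .
  show ?thesis by (rule functionalsI) (fact bracket_gradient[OF assms(1) D assms(2) D'])+
qed

lemma bracket_bracket:
  assumes F: "F \<in> functionals P TX TY" and D: "smooth_gradient F D"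
    and G: "G \<in> functionals P TX TY" and D': "smooth_gradient G D'"
    and D'': "smooth_gradient K D''" and u: "u \<in> X"
  shows "bracket P TX TY (bracket P TX TY F G) K u =
    pairing P (D u [ham_op P (D' u [])]) (ham_op P (D'' u []))
    - pairing P (D' u [ham_op P (D u [])]) (ham_op P (D'' u []))"
proof -
  have mem: "D u [w] \<in> Y" "D' u [w] \<in> Y" if "w \<in> X" for w
    using that smooth_gradient_mem[OF D u, of "[w]"] smooth_gradient_mem[OF D' u, of "[w]"] by auto
  have "bracket P TX TY (bracket P TX TY F G) K u =
      pairing P (D u [ham_op P (D' u [])] - D' u [ham_op P (D u [])]) (ham_op P (D'' u []))"
    by (rule bracket_eq_pairing[OF bracket_gradient(3)[OF F D G D' u]]) (use D'' u in auto)
  then show ?thesis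
    using pairing_lincomb[of "D u [ham_op P (D' u [])]" "D' u [ham_op P (D u [])]" "ham_op P (D'' u [])" 1 "-1"]
      mem D D' D'' u by (simp add: ham_op_mem)
qed

lemma bracket_jacobi:
  assumes F: "F \<in> functionals P TX TY" and G: "G \<in> functionals P TX TY"
    and K: "K \<in> functionals P TX TY" and u: "u \<in> X"
  shows "bracket P TX TY (bracket P TX TY F G) K u + bracket P TX TY (bracket P TX TY K F) G u
    + bracket P TX TY (bracket P TX TY G K) F u = 0"
proof -
  obtain DF where DF: "smooth_gradient F DF" using functionals_smooth_gradient[OF F] .
  obtain DG where DG: "smooth_gradient G DG" using functionals_smooth_gradient[OF G] .
  obtain DK where DK: "smooth_gradient K DK" using functionals_smooth_gradient[OF K] .
  have mem: "ham_op P (DF u []) \<in> X" "ham_op P (DG u []) \<in> X" "ham_op P (DK u []) \<in> X"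
    using DF DG DK u by (auto intro!: ham_op_mem)
  show ?thesis
    \<comment> \<open>Each second derivative occurs twice with opposite signs and its two arguments
      interchanged: that of \<open>F\<close>, for example, is tested on the vector fields of
      \<open>G\<close> and \<open>K\<close> in either order.\<close>
    unfolding bracket_bracket[OF F DF G DG DK u] bracket_bracket[OF K DK F DF DG u]
      bracket_bracket[OF G DG K DK DF u]
    using second_derivative_symmetric[OF F DF u mem(2,3)] second_derivative_symmetric[OF G DG u mem(3,1)]
      second_derivative_symmetric[OF K DK u mem(1,2)] by simp
qed

lemma bracket_antisymmetric: "bracket P TX TY F G u = - bracket P TX TY G F u"
  unfolding bracket_eq_bracket_form by (rule bracket_form_antisymmetric)

text \<open>Linearity of the pairing in its left slot gives both, applied to the gradient of a
  linear combination and to the gradient of a product, which is \<open>G u\<close> times that of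
  \<open>F\<close> plus \<open>F u\<close> times that of \<open>G\<close>.\<close>

lemma
  assumes F: "F \<in> functionals P TX TY" and G: "G \<in> functionals P TX TY"
    and K: "K \<in> functionals P TX TY" and u: "u \<in> X"
  shows bracket_lincomb: "bracket P TX TY (\<lambda>u. c * F u + d * G u) K u =
      c * bracket P TX TY F K u + d * bracket P TX TY G K u"
    and bracket_leibniz: "bracket P TX TY (\<lambda>u. F u * G u) K u =
      F u * bracket P TX TY G K u + bracket P TX TY F K u * G u"
proof -
  obtain DF where "smooth_gradient F DF" using functionals_smooth_gradient[OF F] .
  with u have y: "gradient_at F u (DF u [])" by blast
  obtain DG where "smooth_gradient G DG" using functionals_smooth_gradient[OF G] .
  with u have z: "gradient_at G u (DG u [])" by blast
  obtain DK where "smooth_gradient K DK" using functionals_smooth_gradient[OF K] .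
  with u have k: "gradient_at K u (DK u [])" by blast
  show "bracket P TX TY (\<lambda>u. c * F u + d * G u) K u =
      c * bracket P TX TY F K u + d * bracket P TX TY G K u"
    using y z k by (simp add: bracket_eq_pairing[OF gradient_at_lincomb[OF y z] k]
        bracket_eq_pairing[OF y k] bracket_eq_pairing[OF z k] pairing_lincomb ham_op_mem)
  show "bracket P TX TY (\<lambda>u. F u * G u) K u =
      F u * bracket P TX TY G K u + bracket P TX TY F K u * G u"
    using y z k by (simp add: bracket_eq_pairing[OF gradient_at_mult[OF y z] k]
        bracket_eq_pairing[OF y k] bracket_eq_pairing[OF z k] pairing_lincomb ham_op_mem)
qed

end

theorem proposition1:
  fixes P :: background and TX TY :: "fields topology"
  assumes "valid_background P"
    and "admissible_spaces P TX TY"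
  shows "poisson_bracket_on (topspace TX) (functionals P TX TY) (bracket P TX TY)"
proof -
  interpret bracket_setting P TX TY
    using assms by (simp add: bracket_setting_def bracket_setting_axioms_def)
  have right: "bracket P TX TY K (\<lambda>u. c * F u + d * G u) u =
      c * bracket P TX TY K F u + d * bracket P TX TY K G u"
    if "F \<in> functionals P TX TY" "G \<in> functionals P TX TY" "K \<in> functionals P TX TY" "u \<in> topspace TX"
    for F G K u c d
    using bracket_lincomb[OF that, of c d] by (simp add: bracket_antisymmetric[of K])
  show ?thesis
    unfolding poisson_bracket_on_def
    by (intro conjI ballI allI functionals_lincomb functionals_mult functionals_bracket
        bracket_lincomb right bracket_antisymmetric bracket_leibniz bracket_jacobi)
qed

end
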